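(* Let $k$ be a field and $G$ a finite abelian group. Then there is an isomorphism $\mathcal D^*(kG,kG)\simeq kG\otimes\widehat C^*(G,k)$ of cyclic $A_\infty$-algebras.
   Context: Notation. $\overline G=G\setminus\{1\}$; $g_{i,j}$ denotes the sequence $g_i,g_{i+1},\dots,g_j$ (empty if $j<i$). $C^n(kG,kG)=\mathrm{Map}(\overline G^{\times n},kG)$ and $C_n(kG,kG)=k[G\times\overline G^{\times n}]$ for $n\ge0$ (normalized Hochschild cochains/chains). Cochains are extended by $0$ to tuples having an entry equal to $1$; a chain $(g_0,g_{1,n})$ with some $g_i=1$, $i\ge1$, is $0$; chains are extended linearly in the first entry to elements of $kG$. The Hochschild differentials are $\delta(\varphi)(g_{1,n+1})=g_1\varphi(g_{2,n+1})+\sum_{i=1}^n(-1)^i\varphi(g_{1,i-1},g_ig_{i+1},g_{i+2,n+1})+(-1)^{n+1}\varphi(g_{1,n})g_{n+1}$ and $\partial_n(g_0,g_{1,n})=(g_0g_1,g_{2,n})+\sum_{i=1}^{n-1}(-1)^i(g_0,g_{1,i-1},g_ig_{i+1},g_{i+2,n})+(-1)^n(g_ng_0,g_{1,n-1})$. The Tate-Hochschild cochain complex: $\mathcal D^m(kG,kG)=C^m(kG,kG)$ for $m\ge0$ and $\mathcal D^{-p-1}(kG,kG)=C_p(kG,kG)$ for $p\ge0$. Its differential $\partial'$ (degree $+1$) is $\delta$ on $\mathcal D^{\ge0}$, $(-1)^{p}\partial_p$ on $\mathcal D^{-p-1}=C_p$ for $p\ge1$, and $\tau:C_0=kG\to C^0=kG$,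 $\tau(h)=\sum_{g\in G}ghg^{-1}$ in degree $-1$. Write $|\alpha|$ for the degree in $\mathcal D^*$. Pairing: on $kG$, $\langle g,h\rangle=1$ if $gh=1$ and $0$ otherwise $(g,h\in G)$. On $\mathcal D^*(kG,kG)$: for $\alpha\in C^m$, $\beta=(g_0,g_{1,n})\in C_n$, $\langle\alpha,\beta\rangle=\langle\beta,\alpha\rangle=\langle\alpha(g_{1,n}),g_0\rangle$ if $m=n$, and $0$ otherwise; two cochains, or two chains, pair to $0$. Cup product $\cup$, $\alpha\in\mathcal D^n$, $\beta\in\mathcal D^m$: (1) $n,m\ge0$: $(\alpha\cup\beta)(g_{1,n+m})=\alpha(g_{1,n})\beta(g_{n+1,n+m})$. (2) $\alpha=(g_0,g_{1,s})\in C_s$, $\beta=(h_0,h_{1,t})\in C_t$: $\alpha\cup\beta=\sum_{g\in G}(gh_0,h_{1,t},g^{-1}g_0,g_{1,s})\in C_{s+t+1}$. (3) $\alpha\in C^n$, $\beta=(h_0,h_{1,t})$, $n\le t$: $\alpha\cup\beta=(\alpha(h_{t-n+1,t})h_0,h_{1,t-n})\in C_{t-n}$. (4) $\alpha\in C^n$, $\beta=(g_0,g_{1,t})$, $n\ge t+1$: $(\alpha\cup\beta)(h_{1,n-t-1})=\sum_{g\in G}\alpha(h_{1,n-t-1},g^{-1},g_{1,t})g_0g$. (5) $\alpha=(g_0,g_{1,s})$, $\beta\in C^m$, $m\le s$: $\alpha\cup\beta=(g_0\beta(g_{1,m}),g_{m+1,s})\in C_{s-m}$. (6) $\alpha=(g_0,g_{1,s})$,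 $\beta\in C^m$, $m\ge s+1$: $(\alpha\cup\beta)(h_{1,m-s-1})=\sum_{g\in G}gg_0\beta(g_{1,s},g^{-1},h_{1,m-s-1})$. The operation $m_3$ (degree $-1$) is zero except in the following two cases. (iv) For $\phi\in C^m$, $\varphi\in C^n$, $\alpha=(g_0,g_{1,r})\in C_r$ with $r+2\le m+n$, $m_3(\phi,\alpha,\varphi)\in C^{m+n-r-2}$ is $$m_3(\phi,\alpha,\varphi)(h_{1,m-r+n-2})=\sum_{g\in G}\sum_j(-1)^{m+r+j-1}\phi(h_{1,m-r+j-2},g,g_{j,r})\,g_0\,\varphi(g_{1,j-1},g^{-1},h_{m-r+j-1,m-r+n-2}),$$ $j$ running over $1\le j\le\min\{n,r+1\}$ with $m-r+j-2\ge0$; if $r+2>m+n$ it is $0$. (v) For $\alpha=(g_0,g_{1,r})\in C_r$, $\beta=(h_0,h_{1,s})\in C_s$, $\phi\in C^m$ with $m-1\le r+s$, $$m_3(\alpha,\phi,\beta)=\sum_{g\in G}\sum_j(-1)^{r+s+m-j}\bigl(g_0\phi(g_{1,m-s+j-1},g,h_{j+1,s})h_0,\ h_{1,j},\ g^{-1},\ g_{m-s+j,r}\bigr)\in C_{r+s-m+2},$$ $j$ running over $0\le j\le s$ with $0\le m-s+j-1\le r$; if $m-1>r+s$ it is $0$. An $A_\infty$-algebra has operations $m_i$ of degree $2-i$ satisfying $\sum_{r+s+t=n}(-1)^{r+st}m_{r+1+t}(\mathrm{id}^{\otimes r}\otimes m_s\otimes\mathrm{id}^{\otimes t})=0$ for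 all $n\ge1$ (Koszul sign rule); it is cyclic if $\langle\alpha_0,m_i(\alpha_1,\dots,\alpha_i)\rangle=(-1)^{|\alpha_0|(2-i)+i}\langle m_i(\alpha_0,\dots,\alpha_{i-1}),\alpha_i\rangle$ for the given non-degenerate pairing. It is known (Rivera–Wang) and may be assumed that $(\mathcal D^*(kG,kG),\langle\cdot,\cdot\rangle,m_1=\partial',m_2=\cup,m_3,0,\dots)$ is a cyclic $A_\infty$-algebra. Tate cochain complex. $\widehat C^n(G,k)=\mathrm{Map}(\overline G^{\times n},k)$ for $n\ge0$, $\widehat C^{-s-1}(G,k)=k[\overline G^{\times s}]$ for $s\ge0$ (normalized group cochains and chains with trivial coefficients, spliced in degree $-1$ by multiplication by $|G|$; the differential in negative degrees carries the same sign changes as $\partial'$). The injection $\widehat C^*(G,k)\to\mathcal D^*(kG,kG)$ sending $\varphi:\overline G^{\times n}\to k$ to $\bigl(g_{1,n}\mapsto\varphi(g_{1,n})g_1\cdots g_n\bigr)$ and $(g_{1,s})$ to $(g_s^{-1}\cdots g_1^{-1},g_{1,s})$ has image closed under the operations $m_i$, and $\widehat C^*(G,k)$ carries the cyclic $A_\infty$-structure $(\langle\cdot,\cdot\rangle,m_1,m_2,m_3,0,\dots)$ obtained by restriction. The cyclic $A_\infty$-structure $(\langle\cdot,\cdot\rangle',m_1',m_2',\dots)$ on $kG\otimes\widehat C^*(G,k)$ (for $G$ abelian, $kG$ in degree $0$) is $\langle g_1\otimes\alpha_1,g_2\otimes\alpha_2\rangle'=\langle g_1,g_2\rangle\langle\alpha_1,\alpha_2\rangle$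 and $m_p'(g_1\otimes\alpha_1,\dots,g_p\otimes\alpha_p)=g_1\cdots g_p\otimes m_p(\alpha_1,\dots,\alpha_p)$ for $g_i\in G$, $\alpha_i\in\widehat C^*(G,k)$. *)

theory Defs
  imports
    Complex_Main
    "HOL-Library.Function_Algebras"
    "HOL-Library.Poly_Mapping"
begin

section \<open>Cyclic A-infinity algebras\<close>

text \<open>
  A \<open>\<int>\<close>-graded vector space with a family of operations and a bilinear form.  Both are given on
  homogeneous elements, written as pairs \<open>(n, x)\<close> of a degree and a vector; the operation
  \<open>m\<^sub>p\<close> is the restriction of \<open>oper\<close> to lists of length \<open>p\<close>.
\<close>

record ('k, 'v) graded_struct =
  piece :: "int \<Rightarrow> 'v set"
  scal :: "'k \<Rightarrow> 'v \<Rightarrow> 'v"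
  oper :: "(int \<times> 'v) list \<Rightarrow> 'v"
  form :: "(int \<times> 'v) \<Rightarrow> (int \<times> 'v) \<Rightarrow> 'k"

definition homogeneous :: "('k, 'v) graded_struct \<Rightarrow> (int \<times> 'v) list \<Rightarrow> bool" where
  "homogeneous A xs \<longleftrightarrow> (\<forall>(n, x) \<in> set xs. x \<in> piece A n)"

definition total_deg :: "(int \<times> 'v) list \<Rightarrow> int" where
  "total_deg xs = sum_list (map fst xs)"

definition out_deg :: "(int \<times> 'v) list \<Rightarrow> int" where
  "out_deg xs = total_deg xs + 2 - int (length xs)"

definition happly :: "('k, 'v) graded_struct \<Rightarrow> (int \<times> 'v) list \<Rightarrow> int \<times> 'v" where
  "happly A xs = (out_deg xs, oper A xs)"

text \<open>\<open>sgnp n x\<close> is \<open>(-1)\<^sup>n x\<close>.\<close>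

definition sgnp :: "int \<Rightarrow> 'v::ab_group_add \<Rightarrow> 'v" where
  "sgnp n x = (if even n then x else - x)"

definition graded_space :: "('k::field, 'v::ab_group_add) graded_struct \<Rightarrow> bool" where
  "graded_space A \<longleftrightarrow> vector_space (scal A) \<and> (\<forall>n. module.subspace (scal A) (piece A n))"

definition multilinear_opers :: "('k::field, 'v::ab_group_add) graded_struct \<Rightarrow> bool" where
  "multilinear_opers A \<longleftrightarrow>
     (\<forall>xs. xs \<noteq> [] \<and> homogeneous A xs \<longrightarrow> oper A xs \<in> piece A (out_deg xs)) \<and>
     (\<forall>us n ws. \<forall>x \<in> piece A n. \<forall>y \<in> piece A n. \<forall>c. homogeneous A us \<and> homogeneous A ws \<longrightarrow>
        oper A (us @ (n, x + y) # ws) = oper A (us @ (n, x) # ws) + oper A (us @ (n, y) # ws) \<and>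
        oper A (us @ (n, scal A c x) # ws) = scal A c (oper A (us @ (n, x) # ws)))"

text \<open>
  In the summand for \<open>(r, s, t)\<close> the Koszul rule contributes the sign of moving \<open>m\<^sub>s\<close>, which has
  degree \<open>2 - s\<close>, past the first \<open>r\<close> arguments.
\<close>

definition stasheff :: "('k::field, 'v::ab_group_add) graded_struct \<Rightarrow> bool" where
  "stasheff A \<longleftrightarrow> (\<forall>xs. xs \<noteq> [] \<and> homogeneous A xs \<longrightarrow>
     (\<Sum>(r, s, t) | r + s + t = length xs \<and> 1 \<le> s.
        sgnp (int r + int s * int t + (2 - int s) * total_deg (take r xs))
          (oper A (take r xs @ happly A (take s (drop r xs)) # drop (r + s) xs))) = 0)"

definition bilinear_form :: "('k::field, 'v::ab_group_add) graded_struct \<Rightarrow> bool" where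
  "bilinear_form A \<longleftrightarrow> (\<forall>m n c. \<forall>x \<in> piece A m. \<forall>x' \<in> piece A m. \<forall>y \<in> piece A n. \<forall>y' \<in> piece A n.
     form A (m, x + x') (n, y) = form A (m, x) (n, y) + form A (m, x') (n, y) \<and>
     form A (m, scal A c x) (n, y) = c * form A (m, x) (n, y) \<and>
     form A (m, x) (n, y + y') = form A (m, x) (n, y) + form A (m, x) (n, y') \<and>
     form A (m, x) (n, scal A c y) = c * form A (m, x) (n, y))"

definition nondegenerate :: "('k::field, 'v::ab_group_add) graded_struct \<Rightarrow> bool" where
  "nondegenerate A \<longleftrightarrow> (\<forall>n. \<forall>x \<in> piece A n. x \<noteq> 0 \<longrightarrow>
     (\<exists>m. \<exists>y \<in> piece A m. form A (n, x) (m, y) \<noteq> 0) \<and>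
     (\<exists>m. \<exists>y \<in> piece A m. form A (m, y) (n, x) \<noteq> 0))"

definition cyclic_form :: "('k::field, 'v::ab_group_add) graded_struct \<Rightarrow> bool" where
  "cyclic_form A \<longleftrightarrow> (\<forall>xs. 2 \<le> length xs \<and> homogeneous A xs \<longrightarrow>
     (let i = int (length xs) - 1 in
       form A (hd xs) (happly A (tl xs)) =
         sgnp (fst (hd xs) * (2 - i) + i) (form A (happly A (butlast xs)) (last xs))))"

definition cyclic_Ainf :: "('k::field, 'v::ab_group_add) graded_struct \<Rightarrow> bool" where
  "cyclic_Ainf A \<longleftrightarrow> graded_space A \<and> multilinear_opers A \<and> stasheff A \<and>
     bilinear_form A \<and> nondegenerate A \<and> cyclic_form A"

text \<open>
  An isomorphism is a family of linear bijections, one in each degree, that commutes with every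
  operation and preserves the form.  Equivalently, it is a strict isomorphism in the category of
  cyclic A-infinity algebras, one without higher components.
\<close>

definition cyclic_Ainf_iso ::
  "('k::field, 'v::ab_group_add) graded_struct \<Rightarrow> ('k, 'w::ab_group_add) graded_struct \<Rightarrow>
   (int \<Rightarrow> 'v \<Rightarrow> 'w) \<Rightarrow> bool" where
  "cyclic_Ainf_iso A B f \<longleftrightarrow>
     (\<forall>n. bij_betw (f n) (piece A n) (piece B n)) \<and>
     (\<forall>n. \<forall>x \<in> piece A n. \<forall>y \<in> piece A n. f n (x + y) = f n x + f n y) \<and>
     (\<forall>n c. \<forall>x \<in> piece A n. f n (scal A c x) = scal B c (f n x)) \<and>
     (\<forall>xs. xs \<noteq> [] \<and> homogeneous A xs \<longrightarrow>
        f (out_deg xs) (oper A xs) = oper B (map (\<lambda>(n, x). (n, f n x)) xs)) \<and>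
     (\<forall>m n. \<forall>x \<in> piece A m. \<forall>y \<in> piece A n. form B (m, f m x) (n, f n y) = form A (m, x) (n, y))"


section \<open>The group algebra\<close>

text \<open>
  The finite group \<open>G\<close> is a type, written additively because the convolution product of
  \<^theory>\<open>HOL-Library.Poly_Mapping\<close> is the monoid algebra of an additive monoid: the unit of \<open>G\<close>
  is \<open>0\<close>, the product \<open>g h\<close> is \<open>g + h\<close>, the inverse of \<open>g\<close> is \<open>- g\<close>.  Commutativity is not
  used in any definition.
\<close>

type_synonym ('g, 'k) galg = "'g \<Rightarrow>\<^sub>0 'k"

abbreviation gel :: "'g \<Rightarrow> ('g, 'k::zero_neq_one) galg" where
  "gel g \<equiv> Poly_Mapping.single g 1"

definition galg_form :: "('g::{group_add, finite}, 'k::field) galg \<Rightarrow> ('g, 'k) galg \<Rightarrow> 'k" where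
  "galg_form a b = (\<Sum>g\<in>UNIV. \<Sum>h\<in>UNIV.
     Poly_Mapping.lookup a g * Poly_Mapping.lookup b h * (if g + h = 0 then 1 else 0))"


section \<open>The Tate-Hochschild cochain complex\<close>

text \<open>
  Cochains and chains share one type.  A cochain of degree \<open>n \<ge> 0\<close> is its function on
  \<open>n\<close>-tuples, extended by \<open>0\<close> to all lists.  A chain \<open>c\<close> in \<open>C\<^sub>p\<close> is its coefficient family:
  \<open>lookup (c xs) g\<close> is the coefficient of the basis element \<open>(g, xs)\<close>.
\<close>

type_synonym ('g, 'k) hoch = "'g list \<Rightarrow> ('g, 'k) galg"

definition ntup :: "nat \<Rightarrow> 'g::zero list set" where
  "ntup n = {xs. length xs = n \<and> 0 \<notin> set xs}"

text \<open>Degree \<open>n \<ge> 0\<close> is indexed by \<open>n\<close>-tuples, degree \<open>-p-1\<close> by \<open>p\<close>-tuples.\<close>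

definition tdim :: "int \<Rightarrow> nat" where
  "tdim n = nat (if 0 \<le> n then n else - n - 1)"

definition hoch_scal :: "'k::field \<Rightarrow> ('g, 'k) hoch \<Rightarrow> ('g, 'k) hoch" where
  "hoch_scal c v = (\<lambda>xs. Poly_Mapping.map ((*) c) (v xs))"

definition cochain :: "nat \<Rightarrow> (('g::zero, 'k::field) hoch) \<Rightarrow> ('g, 'k) hoch" where
  "cochain n F = (\<lambda>xs. if xs \<in> ntup n then F xs else 0)"

text \<open>The chain \<open>(a, xs)\<close> with \<open>a\<close> in \<open>kG\<close>; it is \<open>0\<close> if an entry of \<open>xs\<close> is the unit.\<close>

definition chain :: "('g::zero, 'k::field) galg \<Rightarrow> 'g list \<Rightarrow> ('g, 'k) hoch" where
  "chain a xs = (\<lambda>ys. if ys = xs \<and> 0 \<notin> set xs then a else 0)"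

text \<open>Linear extension to \<open>C\<^sub>p\<close> of a map given on the basis elements \<open>(g, xs)\<close>.\<close>

definition chain_lin ::
  "nat \<Rightarrow> ('g::{zero, finite} \<Rightarrow> 'g list \<Rightarrow> ('g, 'k::field) hoch) \<Rightarrow> ('g, 'k) hoch \<Rightarrow> ('g, 'k) hoch"
where
  "chain_lin p T c =
     (\<Sum>xs\<in>ntup p. \<Sum>g\<in>UNIV. hoch_scal (Poly_Mapping.lookup (c xs) g) (T g xs))"

text \<open>For \<open>1 \<le> i < length xs\<close>, multiplies the entries number \<open>i\<close> and \<open>i + 1\<close>, counted from 1.\<close>

definition merge :: "nat \<Rightarrow> 'g::plus list \<Rightarrow> 'g list" where
  "merge i xs = take (i - 1) xs @ (xs ! (i - 1) + xs ! i) # drop (i + 1) xs"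

definition hoch_delta :: "nat \<Rightarrow> ('g::{group_add, finite}, 'k::field) hoch \<Rightarrow> ('g, 'k) hoch" where
  "hoch_delta n \<phi> = cochain (n + 1) (\<lambda>xs.
     gel (hd xs) * \<phi> (tl xs)
     + (\<Sum>i = 1..n. sgnp (int i) (\<phi> (merge i xs)))
     + sgnp (int n + 1) (\<phi> (butlast xs) * gel (last xs)))"

definition hoch_partial :: "nat \<Rightarrow> ('g::{group_add, finite}, 'k::field) hoch \<Rightarrow> ('g, 'k) hoch" where
  "hoch_partial p = chain_lin p (\<lambda>g0 xs.
     chain (gel (g0 + hd xs)) (tl xs)
     + (\<Sum>i = 1..<p. sgnp (int i) (chain (gel g0) (merge i xs)))
     + sgnp (int p) (chain (gel (last xs + g0)) (butlast xs)))"

definition hoch_tau :: "('g::{group_add, finite}, 'k::field) hoch \<Rightarrow> ('g, 'k) hoch" where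
  "hoch_tau = chain_lin 0 (\<lambda>h _. cochain 0 (\<lambda>_. \<Sum>g\<in>UNIV. gel (g + h + (- g))))"

definition tate_diff :: "int \<Rightarrow> ('g::{group_add, finite}, 'k::field) hoch \<Rightarrow> ('g, 'k) hoch" where
  "tate_diff n v =
     (if 0 \<le> n then hoch_delta (tdim n) v
      else if n = - 1 then hoch_tau v
      else sgnp (int (tdim n)) (hoch_partial (tdim n) v))"

definition tate_form ::
  "int \<times> ('g::{group_add, finite}, 'k::field) hoch \<Rightarrow> int \<times> ('g, 'k) hoch \<Rightarrow> 'k" where
  "tate_form = (\<lambda>(m, v) (n, w).
     (let pair = (\<lambda>p \<alpha> \<beta>. \<Sum>xs\<in>ntup p. \<Sum>g\<in>UNIV.
                   Poly_Mapping.lookup (\<beta> xs) g * galg_form (\<alpha> xs) (gel g)) in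
      if 0 \<le> m \<and> n < 0 \<and> tdim m = tdim n then pair (tdim m) v w
      else if m < 0 \<and> 0 \<le> n \<and> tdim m = tdim n then pair (tdim m) w v
      else 0))"

text \<open>The first two arguments of the cup product and the first three of \<open>m\<^sub>3\<close> are degrees.\<close>

definition tate_cup ::
  "int \<Rightarrow> int \<Rightarrow> ('g::{group_add, finite}, 'k::field) hoch \<Rightarrow> ('g, 'k) hoch \<Rightarrow> ('g, 'k) hoch"
where
  "tate_cup d e \<alpha> \<beta> = (let n = tdim d; m = tdim e in
     if 0 \<le> d \<and> 0 \<le> e then
       cochain (n + m) (\<lambda>xs. \<alpha> (take n xs) * \<beta> (drop n xs))
     else if d < 0 \<and> e < 0 then
       chain_lin n (\<lambda>g0 xs. chain_lin m (\<lambda>h0 ys.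
         \<Sum>g\<in>UNIV. chain (gel (g + h0)) (ys @ (- g + g0) # xs)) \<beta>) \<alpha>
     else if 0 \<le> d then
       chain_lin m (\<lambda>h0 ys.
         if n \<le> m then chain (\<alpha> (drop (m - n) ys) * gel h0) (take (m - n) ys)
         else cochain (n - m - 1) (\<lambda>hs. \<Sum>g\<in>UNIV. \<alpha> (hs @ (- g) # ys) * gel h0 * gel g)) \<beta>
     else
       chain_lin n (\<lambda>g0 xs.
         if m \<le> n then chain (gel g0 * \<beta> (take m xs)) (drop m xs)
         else cochain (m - n - 1) (\<lambda>hs. \<Sum>g\<in>UNIV. gel g * gel g0 * \<beta> (xs @ (- g) # hs))) \<alpha>)"

definition tate_m3 ::
  "int \<Rightarrow> int \<Rightarrow> int \<Rightarrow> ('g::{group_add, finite}, 'k::field) hoch \<Rightarrow> ('g, 'k) hoch \<Rightarrow> ('g, 'k) hoch \<Rightarrow>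
   ('g, 'k) hoch" where
  "tate_m3 d e f u v w =
     (if 0 \<le> d \<and> e < 0 \<and> 0 \<le> f then
        (let m = tdim d; r = tdim e; n = tdim f in
         if r + 2 \<le> m + n then
           chain_lin r (\<lambda>g0 xs. cochain (m + n - r - 2) (\<lambda>hs.
             \<Sum>g\<in>UNIV. \<Sum>j | 1 \<le> j \<and> j \<le> min n (r + 1) \<and> r + 2 \<le> m + j.
               (let l = m + j - r - 2 in
                sgnp (int m + int r + int j - 1)
                  (u (take l hs @ g # drop (j - 1) xs) * gel g0
                   * w (take (j - 1) xs @ (- g) # drop l hs))))) v
         else 0)
      else if d < 0 \<and> 0 \<le> e \<and> f < 0 then
        (let r = tdim d; m = tdim e; s = tdim f in
         if m \<le> r + s + 1 then
           chain_lin r (\<lambda>g0 xs. chain_lin s (\<lambda>h0 ys.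
             \<Sum>g\<in>UNIV. \<Sum>j | j \<le> s \<and> s + 1 \<le> m + j \<and> m + j - s - 1 \<le> r.
               (let l = m + j - s - 1 in
                sgnp (int r + int s + int m - int j)
                  (chain (gel g0 * v (take l xs @ g # drop j ys) * gel h0)
                         (take j ys @ (- g) # drop l xs)))) w) u
         else 0)
      else 0)"

fun tate_oper :: "(int \<times> ('g::{group_add, finite}, 'k::field) hoch) list \<Rightarrow> ('g, 'k) hoch" where
  "tate_oper [(n, x)] = tate_diff n x"
| "tate_oper [(n, x), (m, y)] = tate_cup n m x y"
| "tate_oper [(n, x), (m, y), (l, z)] = tate_m3 n m l x y z"
| "tate_oper _ = 0"

definition tate_hochschild ::
  "'k::field itself \<Rightarrow> 'g::{group_add, finite} itself \<Rightarrow> ('k, ('g, 'k) hoch) graded_struct" where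
  "tate_hochschild _ _ =
     \<lparr>piece = (\<lambda>n. {v. \<forall>xs. xs \<notin> ntup (tdim n) \<longrightarrow> v xs = 0}),
      scal = hoch_scal, oper = tate_oper, form = tate_form\<rparr>"


section \<open>The Tate cochain complex of the group\<close>

type_synonym ('g, 'k) tate = "'g list \<Rightarrow> 'k"

definition tate_comp :: "int \<Rightarrow> ('g::zero, 'k::field) tate set" where
  "tate_comp n = {\<phi>. \<forall>xs. xs \<notin> ntup (tdim n) \<longrightarrow> \<phi> xs = 0}"

text \<open>
  The embedding into the Tate-Hochschild complex.  In negative degrees it sends the basis
  element \<open>xs\<close> to \<open>(g\<^sub>s\<^sup>-\<^sup>1 \<dots> g\<^sub>1\<^sup>-\<^sup>1, xs)\<close>.
\<close>

definition tate_embed :: "int \<Rightarrow> ('g::group_add, 'k::field) tate \<Rightarrow> ('g, 'k) hoch" where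
  "tate_embed n \<phi> = (\<lambda>xs.
     if 0 \<le> n then Poly_Mapping.single (sum_list xs) (\<phi> xs)
     else Poly_Mapping.single (sum_list (map uminus (rev xs))) (\<phi> xs))"

text \<open>Operations and form are restricted along the embedding, whose image is closed under them.\<close>

definition tate_group ::
  "'k::field itself \<Rightarrow> 'g::{group_add, finite} itself \<Rightarrow> ('k, ('g, 'k) tate) graded_struct" where
  "tate_group _ _ =
     \<lparr>piece = tate_comp,
      scal = (\<lambda>c \<phi> xs. c * \<phi> xs),
      oper = (\<lambda>xs. inv_into (tate_comp (out_deg xs)) (tate_embed (out_deg xs))
                (tate_oper (map (\<lambda>(n, \<phi>). (n, tate_embed n \<phi>)) xs))),
      form = (\<lambda>(m, \<phi>) (n, \<psi>). tate_form (m, tate_embed m \<phi>) (n, tate_embed n \<psi>))\<rparr>"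


section \<open>Tensoring with the group algebra\<close>

text \<open>
  \<open>kG \<otimes> V\<close> is the type of formal sums over \<open>G\<close> with coefficients in \<open>V\<close>, with
  \<open>g \<otimes> x\<close> being \<open>single g x\<close>; operations and form are extended multilinearly from such
  elements.
\<close>

definition galg_tensor ::
  "'g::{group_add, finite} itself \<Rightarrow> ('k::field, 'v::ab_group_add) graded_struct \<Rightarrow>
   ('k, 'g \<Rightarrow>\<^sub>0 'v) graded_struct" where
  "galg_tensor _ A =
     \<lparr>piece = (\<lambda>n. {F. \<forall>g. Poly_Mapping.lookup F g \<in> piece A n}),
      scal = (\<lambda>c. Poly_Mapping.map (scal A c)),
      oper = (\<lambda>xs. \<Sum>gs | length gs = length xs.
         Poly_Mapping.single (sum_list gs)
           (oper A (map2 (\<lambda>g (n, F). (n, Poly_Mapping.lookup F g)) gs xs))),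
      form = (\<lambda>(m, F) (n, H). \<Sum>g\<in>UNIV. \<Sum>h\<in>UNIV.
         galg_form (gel g) (gel h :: ('g, 'k) galg)
           * form A (m, Poly_Mapping.lookup F g) (n, Poly_Mapping.lookup H h))\<rparr>"

end

theory Submission
  imports Defs
begin

text \<open>
  Two facts carry the proof.  Both concern the action of \<open>kG\<close> on the Tate-Hochschild complex that
  multiplies the values of a cochain, or the first entries of a chain.

  Since \<open>G\<close> is abelian, \<open>kG\<close> is commutative, and each of the operations \<open>m\<^sub>1\<close>, \<open>m\<^sub>2\<close>, \<open>m\<^sub>3\<close> is
  \<open>kG\<close>-linear in every argument (lemma \<open>kG_linear_oper\<close>): the values of cochains and the
  first entries of chains only enter the formulas as factors of a product in \<open>kG\<close>, for the
  cup product of two chains after a substitution in the sum over \<open>G\<close>.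

  The complex is also graded by \<open>G\<close>.  With \<open>G\<close> written additively, a basis
  chain \<open>(g\<^sub>0, g\<^sub>1, \<dots>, g\<^sub>s)\<close> has as weight the sum of all its entries,
  and a cochain has weight \<open>c\<close> if its value on \<open>(g\<^sub>1, \<dots>, g\<^sub>n)\<close> is a
  multiple of the group element \<open>c + g\<^sub>1 + \<dots> + g\<^sub>n\<close>.  The part of weight zero is exactly the image of
  the Tate cochain complex of \<open>G\<close>; the operations preserve it (lemma \<open>weightless_oper\<close>), and \<open>c\<close> in \<open>G\<close>
  maps it bijectively onto the part of weight \<open>c\<close>.  So the complex is \<open>kG\<close> tensored with its part of
  weight zero, and the isomorphism \<open>weight_split\<close> takes an element apart into its components of each
  weight, shifted back to weight zero.

  By \<open>kG\<close>-multilinearity an operation on the whole complex is determined by its restriction to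
  weight zero, in the way that defines the operations on the tensor product (lemma
  \<open>oper_expand\<close>).  The form is the coefficient at the unit of a product in \<open>kG\<close>, so that the
  weights \<open>g\<close> and \<open>h\<close> pair to zero unless \<open>g + h = 0\<close>, which is the form of \<open>kG\<close> on group elements
  (lemma \<open>pairing_weight_split\<close>).

  The axioms for the tensor product then follow from those for the Tate-Hochschild complex by
  transport along the isomorphism (theorem \<open>cyclic_Ainf_B\<close>).
\<close>

section \<open>Transport of cyclic A-infinity structures\<close>

text \<open>
  The linear structure of the target is a hypothesis of its own: the scalar multiplication of a
  graded structure acts on the whole ambient type, and an isomorphism only sees the graded pieces.
\<close>

locale cyclic_transport =
  fixes A :: "('k::field, 'v::ab_group_add) graded_struct"
    and B :: "('k, 'w::ab_group_add) graded_struct"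
    and f :: "int \<Rightarrow> 'v \<Rightarrow> 'w"
  assumes iso: "cyclic_Ainf_iso A B f"
    and cyclic_A: "cyclic_Ainf A"
    and graded_B: "graded_space B"
begin

sublocale A: vector_space "scal A" using cyclic_A by (simp add: cyclic_Ainf_def graded_space_def)
sublocale B: vector_space "scal B" using graded_B by (simp add: graded_space_def)

lemma subspace_A: "A.subspace (piece A n)"
  using cyclic_A by (simp add: cyclic_Ainf_def graded_space_def)

lemma f_piece: "x \<in> piece A n \<Longrightarrow> f n x \<in> piece B n"
  using iso by (auto simp: cyclic_Ainf_iso_def bij_betw_def)
lemma f_add: "x \<in> piece A n \<Longrightarrow> y \<in> piece A n \<Longrightarrow> f n (x + y) = f n x + f n y"
  using iso by (auto simp: cyclic_Ainf_iso_def)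
lemma f_scal: "x \<in> piece A n \<Longrightarrow> f n (scal A c x) = scal B c (f n x)"
  using iso by (auto simp: cyclic_Ainf_iso_def)
lemma f_form: "x \<in> piece A m \<Longrightarrow> y \<in> piece A n \<Longrightarrow> form B (m, f m x) (n, f n y) = form A (m, x) (n, y)"
  using iso by (auto simp: cyclic_Ainf_iso_def)
lemma f_surj: "y \<in> piece B n \<Longrightarrow> \<exists>x \<in> piece A n. y = f n x"
proof -
  assume "y \<in> piece B n"
  moreover have "f n ` piece A n = piece B n" using iso by (simp add: cyclic_Ainf_iso_def bij_betw_def)
  ultimately show ?thesis by blast
qed
lemma f_zero: "f n 0 = 0"
  using f_add[of 0 n 0] A.subspace_0[OF subspace_A] by simp
lemma f_sgnp: "x \<in> piece A n \<Longrightarrow> f n (sgnp i x) = sgnp i (f n x)"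
  using f_scal[of x n "-1"] by (simp add: sgnp_def)
lemma f_sum: "(\<And>i. i \<in> S \<Longrightarrow> F i \<in> piece A n) \<Longrightarrow> f n (sum F S) = (\<Sum>i\<in>S. f n (F i))"
  by (induction S rule: infinite_finite_induct)
     (auto simp: f_zero f_add A.subspace_sum[OF subspace_A])

definition push :: "int \<times> 'v \<Rightarrow> int \<times> 'w" where
  "push = (\<lambda>(n, x). (n, f n x))"

lemma push_pair [simp]: "push (n, x) = (n, f n x)" and fst_push [simp]: "fst (push p) = fst p"
  by (simp_all add: push_def split_beta)

lemma degrees_push [simp]: "total_deg (map push xs) = total_deg xs" "out_deg (map push xs) = out_deg xs"
  by (simp_all add: total_deg_def out_deg_def o_def)

text \<open>
  All axioms quantify over lists of homogeneous elements of \<open>B\<close>; this replaces such a list by one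
  over \<open>A\<close>, where the axioms are known.
\<close>

lemma homogeneous_lift: "homogeneous B ws \<Longrightarrow> \<exists>xs. homogeneous A xs \<and> ws = map push xs"
proof (induction ws)
  case Nil
  show ?case by (simp add: homogeneous_def)
next
  case (Cons w ws)
  obtain n y where w: "w = (n, y)" by fastforce
  with Cons.prems have "y \<in> piece B n" "homogeneous B ws" by (simp_all add: homogeneous_def)
  with f_surj Cons.IH obtain x xs where "x \<in> piece A n" "y = f n x" "homogeneous A xs" "ws = map push xs"
    by blast
  with w have "homogeneous A ((n, x) # xs)" "w # ws = map push ((n, x) # xs)"
    by (simp_all add: homogeneous_def)
  then show ?case by (intro exI conjI)
qed

lemma oper_piece: "xs \<noteq> [] \<Longrightarrow> homogeneous A xs \<Longrightarrow> oper A xs \<in> piece A (out_deg xs)"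
  using cyclic_A by (simp add: cyclic_Ainf_def multilinear_opers_def)

lemma oper_push: "xs \<noteq> [] \<Longrightarrow> homogeneous A xs \<Longrightarrow> oper B (map push xs) = f (out_deg xs) (oper A xs)"
  using iso by (simp add: cyclic_Ainf_iso_def push_def)

lemma happly_push: "xs \<noteq> [] \<Longrightarrow> homogeneous A xs \<Longrightarrow> happly B (map push xs) = push (happly A xs)"
  by (simp add: happly_def oper_push)

lemma form_push:
  "fst p = m \<Longrightarrow> snd p \<in> piece A m \<Longrightarrow> fst q = n \<Longrightarrow> snd q \<in> piece A n \<Longrightarrow>
    form B (push p) (push q) = form A p q"
  using f_form[of "snd p" m "snd q" n] by (cases p; cases q) auto

lemma multilinear_B: "multilinear_opers B"
  unfolding multilinear_opers_def
proof (intro conjI allI ballI impI)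
  fix ws assume ws: "ws \<noteq> [] \<and> homogeneous B ws"
  with homogeneous_lift[of ws] obtain xs where "homogeneous A xs" "ws = map push xs" by blast
  moreover from this ws have "xs \<noteq> []" by simp
  ultimately show "oper B ws \<in> piece B (out_deg ws)"
    by (simp add: oper_push f_piece oper_piece)
next
  fix us ws n c x' y' assume x'y': "x' \<in> piece B n" "y' \<in> piece B n"
    and uw: "homogeneous B us \<and> homogeneous B ws"
  from x'y' obtain x y where x: "x \<in> piece A n" "x' = f n x" and y: "y \<in> piece A n" "y' = f n y"
    using f_surj by blast
  from uw obtain vs zs where vs: "homogeneous A vs" "us = map push vs"
    and zs: "homogeneous A zs" "ws = map push zs"
    using homogeneous_lift[of us] homogeneous_lift[of ws] by blast
  let ?l = "\<lambda>x. vs @ (n, x) # zs"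
  \<comment> \<open>The degree of a list does not see its vectors, so one component of \<open>f\<close> serves for all values in the slot.\<close>
  have out: "out_deg (?l x) = out_deg (?l 0)" for x by (simp add: out_deg_def total_deg_def)
  have slot: "oper A (?l x) \<in> piece A (out_deg (?l 0))"
      "oper B (us @ (n, f n x) # ws) = f (out_deg (?l 0)) (oper A (?l x))"
    if "x \<in> piece A n" for x
  proof -
    have "homogeneous A (?l x)" using that vs zs by (auto simp: homogeneous_def)
    then show "oper A (?l x) \<in> piece A (out_deg (?l 0))"
        "oper B (us @ (n, f n x) # ws) = f (out_deg (?l 0)) (oper A (?l x))"
      using oper_push[of "?l x"] oper_piece[of "?l x"] out[of x] by (simp_all add: vs zs)
  qed
  have A: "oper A (?l (x + y)) = oper A (?l x) + oper A (?l y)"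
      "oper A (?l (scal A c x)) = scal A c (oper A (?l x))"
    using cyclic_A x(1) y(1) vs(1) zs(1) by (auto simp: cyclic_Ainf_def multilinear_opers_def)
  have "oper B (us @ (n, x' + y') # ws) = f (out_deg (?l 0)) (oper A (?l x) + oper A (?l y))"
    unfolding x y f_add[OF x(1) y(1), symmetric] A[symmetric]
    by (rule slot(2)[OF A.subspace_add[OF subspace_A x(1) y(1)]])
  then show "oper B (us @ (n, x' + y') # ws) = oper B (us @ (n, x') # ws) + oper B (us @ (n, y') # ws)"
    unfolding x y slot(2)[OF x(1)] slot(2)[OF y(1)] f_add[OF slot(1)[OF x(1)] slot(1)[OF y(1)]] .
  have "oper B (us @ (n, scal B c x') # ws) = f (out_deg (?l 0)) (scal A c (oper A (?l x)))"
    unfolding x f_scal[OF x(1), symmetric] A[symmetric]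
    by (rule slot(2)[OF A.subspace_scale[OF subspace_A x(1)]])
  then show "oper B (us @ (n, scal B c x') # ws) = scal B c (oper B (us @ (n, x') # ws))"
    unfolding x slot(2)[OF x(1)] f_scal[OF slot(1)[OF x(1)]] .
qed

lemma stasheff_B: "stasheff B"
  unfolding stasheff_def
proof (intro allI impI)
  fix ws assume ws: "ws \<noteq> [] \<and> homogeneous B ws"
  with homogeneous_lift[of ws] obtain xs where xs: "homogeneous A xs" "ws = map push xs" by blast
  with ws have ne_xs: "xs \<noteq> []" by simp
  define I where "I = {(r, s, t). r + s + t = length xs \<and> 1 \<le> s}"
  \<comment> \<open>All summands of the Stasheff identity lie in the one degree \<open>N\<close>, so that the linear map \<open>f N\<close> can be applied to the identity in \<open>A\<close>.\<close>
  define N where "N = total_deg xs + 3 - int (length xs)"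
  define ins where "ins r s = take r xs @ happly A (take s (drop r xs)) # drop (r + s) xs" for r s
  define sg where "sg r s t = int r + int s * int t + (2 - int s) * total_deg (take r xs)" for r s t
  have ins: "homogeneous A (ins r s)" "out_deg (ins r s) = N"
      "take r ws @ happly B (take s (drop r ws)) # drop (r + s) ws = map push (ins r s)"
    if "(r, s, t) \<in> I" for r s t
  proof -
    from that have rs: "r + s \<le> length xs" "1 \<le> s" by (auto simp: I_def)
    then have inner: "take s (drop r xs) \<noteq> []" "homogeneous A (take s (drop r xs))"
      using xs(1) by (auto simp: homogeneous_def dest!: in_set_takeD in_set_dropD)
    have "homogeneous A (take r xs)" "homogeneous A (drop (r + s) xs)"
      using xs(1) by (auto simp: homogeneous_def dest!: in_set_takeD in_set_dropD)
    then show "homogeneous A (ins r s)"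
      using oper_piece[OF inner] by (auto simp: ins_def homogeneous_def happly_def)
    have "xs = take r xs @ take s (drop r xs) @ drop (r + s) xs"
      by (metis add.commute append_take_drop_id drop_drop)
    then have "total_deg xs = total_deg (take r xs) + total_deg (take s (drop r xs)) + total_deg (drop (r + s) xs)"
      by (metis add.assoc map_append sum_list_append total_deg_def)
    with rs show "out_deg (ins r s) = N"
      by (simp add: out_deg_def ins_def happly_def N_def total_deg_def of_nat_diff)
    show "take r ws @ happly B (take s (drop r ws)) # drop (r + s) ws = map push (ins r s)"
      using happly_push[OF inner] by (simp add: xs(2) ins_def take_map drop_map)
  qed
  have ne: "ins r s \<noteq> []" for r s by (simp add: ins_def)
  have piece: "oper A (ins r s) \<in> piece A N" if "(r, s, t) \<in> I" for r s t
    using oper_piece[OF ne ins(1)[OF that]] ins(2)[OF that] by simp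
  have sgnp_piece: "sgnp i x \<in> piece A N" if "x \<in> piece A N" for i x
    using that A.subspace_neg[OF subspace_A that] by (simp add: sgnp_def)
  have "(\<Sum>(r, s, t)\<in>I. sgnp (sg r s t) (oper B (take r ws @ happly B (take s (drop r ws)) # drop (r + s) ws)))
      = (\<Sum>(r, s, t)\<in>I. f N (sgnp (sg r s t) (oper A (ins r s))))"
    by (rule sum.cong) (auto simp: ins oper_push[OF ne] f_sgnp piece)
  also have "\<dots> = f N (\<Sum>(r, s, t)\<in>I. sgnp (sg r s t) (oper A (ins r s)))"
    using piece sgnp_piece by (subst f_sum) (auto simp: split_beta)
  also have "(\<Sum>(r, s, t)\<in>I. sgnp (sg r s t) (oper A (ins r s))) = 0"
    using cyclic_A xs(1) ne_xs unfolding cyclic_Ainf_def stasheff_def I_def sg_def ins_def by simp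
  finally show "(\<Sum>(r, s, t) | r + s + t = length ws \<and> 1 \<le> s.
        sgnp (int r + int s * int t + (2 - int s) * total_deg (take r ws))
          (oper B (take r ws @ happly B (take s (drop r ws)) # drop (r + s) ws))) = 0"
    unfolding I_def sg_def by (simp add: f_zero xs(2) take_map)
qed

lemma bilinear_B: "bilinear_form B"
  unfolding bilinear_form_def
proof (intro allI ballI)
  fix m n c u u' w w'
  assume mem: "u \<in> piece B m" "u' \<in> piece B m" "w \<in> piece B n" "w' \<in> piece B n"
  obtain x where x: "x \<in> piece A m" "u = f m x" using f_surj[OF mem(1)] by blast
  obtain x' where x': "x' \<in> piece A m" "u' = f m x'" using f_surj[OF mem(2)] by blast
  obtain y where y: "y \<in> piece A n" "w = f n y" using f_surj[OF mem(3)] by blast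
  obtain y' where y': "y' \<in> piece A n" "w' = f n y'" using f_surj[OF mem(4)] by blast
  have "bilinear_form A" using cyclic_A by (simp add: cyclic_Ainf_def)
  then show "form B (m, u + u') (n, w) = form B (m, u) (n, w) + form B (m, u') (n, w) \<and>
     form B (m, scal B c u) (n, w) = c * form B (m, u) (n, w) \<and>
     form B (m, u) (n, w + w') = form B (m, u) (n, w) + form B (m, u) (n, w') \<and>
     form B (m, u) (n, scal B c w) = c * form B (m, u) (n, w)"
    using x(1) x'(1) y(1) y'(1)
    unfolding x(2) x'(2) y(2) y'(2) bilinear_form_def f_add[OF x(1) x'(1), symmetric]
      f_add[OF y(1) y'(1), symmetric] f_scal[OF x(1), symmetric] f_scal[OF y(1), symmetric]
    by (simp add: f_form A.subspace_add[OF subspace_A] A.subspace_scale[OF subspace_A])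
qed

lemma nondegenerate_B: "nondegenerate B"
  unfolding nondegenerate_def
proof (intro allI ballI impI)
  fix n u assume u: "u \<in> piece B n" "u \<noteq> 0"
  from f_surj[OF u(1)] obtain x where x: "x \<in> piece A n" "u = f n x" by blast
  with u(2) f_zero have "x \<noteq> 0" by auto
  have "nondegenerate A" using cyclic_A by (simp add: cyclic_Ainf_def)
  with x(1) \<open>x \<noteq> 0\<close> obtain m y m' y' where "y \<in> piece A m" "form A (n, x) (m, y) \<noteq> 0"
      "y' \<in> piece A m'" "form A (m', y') (n, x) \<noteq> 0"
    unfolding nondegenerate_def by blast
  then have "f m y \<in> piece B m" "form B (n, u) (m, f m y) \<noteq> 0"
      "f m' y' \<in> piece B m'" "form B (m', f m' y') (n, u) \<noteq> 0"
    using x by (simp_all add: f_piece f_form)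
  then show "(\<exists>m. \<exists>y \<in> piece B m. form B (n, u) (m, y) \<noteq> 0) \<and>
     (\<exists>m. \<exists>y \<in> piece B m. form B (m, y) (n, u) \<noteq> 0)"
    by blast
qed

lemma cyclic_B: "cyclic_form B"
  unfolding cyclic_form_def
proof (intro allI impI)
  fix ws assume ws: "2 \<le> length ws \<and> homogeneous B ws"
  then obtain xs where xs: "homogeneous A xs" "ws = map push xs"
    using homogeneous_lift[of ws] by blast
  with ws have len: "2 \<le> length xs" by simp
  then have ne: "xs \<noteq> []" "tl xs \<noteq> []" "butlast xs \<noteq> []"
    by (auto simp: neq_Nil_conv Suc_le_length_iff numeral_2_eq_2)
  have sub: "homogeneous A (tl xs)" "homogeneous A (butlast xs)"
    using xs(1) ne(1) by (auto simp: homogeneous_def dest: list.set_sel(2) in_set_butlastD)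
  have ends: "snd (hd xs) \<in> piece A (fst (hd xs))" "snd (last xs) \<in> piece A (fst (last xs))"
    using xs(1) ne(1) hd_in_set[of xs] last_in_set[of xs] by (auto simp: homogeneous_def split_beta)
  have out: "snd (happly A ys) \<in> piece A (fst (happly A ys))" if "ys \<noteq> []" "homogeneous A ys" for ys
    using oper_piece[OF that] by (simp add: happly_def)
  have "form B (hd ws) (happly B (tl ws)) = form A (hd xs) (happly A (tl xs))"
    using ne sub ends out
    by (simp add: xs(2) map_tl[symmetric] hd_map happly_push form_push[OF refl _ refl])
  moreover have "form B (happly B (butlast ws)) (last ws) = form A (happly A (butlast xs)) (last xs)"
    using ne sub ends out
    by (simp add: xs(2) map_butlast[symmetric] last_map happly_push form_push[OF refl _ refl])
  moreover have "cyclic_form A" using cyclic_A by (simp add: cyclic_Ainf_def)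
  ultimately show "let i = int (length ws) - 1 in
       form B (hd ws) (happly B (tl ws)) =
         sgnp (fst (hd ws) * (2 - i) + i) (form B (happly B (butlast ws)) (last ws))"
    using xs len ne unfolding cyclic_form_def by (simp add: hd_map Let_def)
qed

theorem cyclic_Ainf_B: "cyclic_Ainf B"
  using graded_B multilinear_B stasheff_B bilinear_B nondegenerate_B cyclic_B
  by (simp add: cyclic_Ainf_def)

end

section \<open>Linearity over the group algebra\<close>

definition kG_scale :: "('g::ab_group_add, 'k::field) galg \<Rightarrow> ('g, 'k) hoch \<Rightarrow> ('g, 'k) hoch" where
  "kG_scale a v = (\<lambda>xs. a * v xs)"

lemma kG_scale_add: "kG_scale a (v + w) = kG_scale a v + kG_scale a w"
  by (simp add: kG_scale_def fun_eq_iff algebra_simps)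

lemma kG_scale_add_left: "kG_scale (a + b) v = kG_scale a v + kG_scale b v"
  by (simp add: kG_scale_def fun_eq_iff algebra_simps)

lemma kG_scale_zero [simp]: "kG_scale a 0 = 0"
  by (simp add: kG_scale_def fun_eq_iff)

lemma kG_scale_zero_left: "kG_scale 0 v = 0"
  by (simp add: kG_scale_def fun_eq_iff)

lemma kG_scale_kG_scale: "kG_scale a (kG_scale b v) = kG_scale (a * b) v"
  by (simp add: kG_scale_def fun_eq_iff algebra_simps)

lemma kG_scale_sum: "kG_scale a (sum F S) = (\<Sum>i\<in>S. kG_scale a (F i))"
  using sum_comp_morphism[of "kG_scale a" F S] by (simp add: kG_scale_add o_def)

lemma kG_scale_sum_left: "kG_scale (sum F S) v = (\<Sum>i\<in>S. kG_scale (F i) v)"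
  using sum_comp_morphism[of "\<lambda>a. kG_scale a v" F S]
  by (simp add: kG_scale_add_left o_def kG_scale_zero_left)

lemma module_kG_scale: "module (kG_scale :: ('g::ab_group_add, 'k::field) galg \<Rightarrow> _)"
  by unfold_locales (simp_all add: kG_scale_def fun_eq_iff algebra_simps)

lemma module_kG: "module ((*) :: ('g::ab_group_add, 'k::field) galg \<Rightarrow> _)"
  by unfold_locales (simp_all add: algebra_simps)

lemma gel_add: "(gel (g + h) :: ('g::ab_group_add, 'k::field) galg) = gel g * gel h"
  by (simp add: mult_single)

lemma hoch_scal_eq: "hoch_scal c v = kG_scale (Poly_Mapping.single 0 c) (v :: ('g::{ab_group_add,finite}, 'k::field) hoch)"
  by (simp add: hoch_scal_def kG_scale_def mult_map_scale_conv_mult)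

lemma sum_gel:
  fixes a :: "('g::{ab_group_add,finite}, 'k::field) galg"
  shows "(\<Sum>g\<in>UNIV. Poly_Mapping.single 0 (Poly_Mapping.lookup a g) * gel g) = a"
  by (rule poly_mapping_eqI) (simp add: mult_single lookup_sum lookup_single when_def)

lemma sgnp_mult: "sgnp n (a * b) = a * sgnp n (b :: 'a::ring)" by (simp add: sgnp_def)
lemma sgnp_add: "sgnp n (a + b) = sgnp n a + sgnp n b" by (simp add: sgnp_def)
lemma sgnp_apply: "sgnp n F x = sgnp n (F x)" by (simp add: sgnp_def)
lemma sgnp_zero [simp]: "sgnp n 0 = 0" by (simp add: sgnp_def)

lemma kG_scale_sgnp: "kG_scale a (sgnp n v) = sgnp n (kG_scale a v)"
  by (simp add: kG_scale_def sgnp_def fun_eq_iff)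

lemma kG_scale_chain: "kG_scale a (chain b xs) = chain (a * b) xs"
  by (simp add: kG_scale_def chain_def fun_eq_iff)

lemma kG_scale_cochain: "kG_scale a (cochain n F) = cochain n (\<lambda>xs. a * F xs)"
  by (simp add: kG_scale_def cochain_def fun_eq_iff)

text \<open>
  A map given on the basis elements \<open>(g, xs)\<close> that is equivariant in \<open>g\<close> extends \<open>kG\<close>-linearly in
  the first entry, so the sum over \<open>g\<close> collapses.
\<close>

lemma chain_lin_eq:
  assumes "\<And>g xs. T g xs = kG_scale (gel g) (U xs)"
  shows "chain_lin p T c = (\<Sum>xs\<in>ntup p. kG_scale (c xs) (U xs))"
proof -
  have "(\<Sum>g\<in>UNIV. hoch_scal (Poly_Mapping.lookup (c xs) g) (T g xs)) = kG_scale (c xs) (U xs)" for xs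
  proof -
    have "(\<Sum>g\<in>UNIV. hoch_scal (Poly_Mapping.lookup (c xs) g) (T g xs)) =
       kG_scale (\<Sum>g\<in>UNIV. Poly_Mapping.single 0 (Poly_Mapping.lookup (c xs) g) * gel g) (U xs)"
      by (simp only: assms hoch_scal_eq kG_scale_kG_scale kG_scale_sum_left)
    then show ?thesis by (simp only: sum_gel)
  qed
  then show ?thesis by (simp add: chain_lin_def)
qed

lemma kG_scale_chain_lin: "kG_scale a (chain_lin p T c) = chain_lin p (\<lambda>h ys. kG_scale a (T h ys)) c"
  by (simp add: chain_lin_def kG_scale_sum hoch_scal_eq kG_scale_kG_scale mult_ac)

text \<open>
  Using the commutative ring \<open>kG\<close> as scalars covers additivity, the \<open>k\<close>-action and the
  action of the group at once.
\<close>

abbreviation kG_linear :: "(('g::{ab_group_add,finite}, 'k::field) hoch \<Rightarrow> ('g, 'k) hoch) \<Rightarrow> bool" where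
  "kG_linear \<equiv> module_hom kG_scale kG_scale"

abbreviation kG_functional :: "(('g::{ab_group_add,finite}, 'k::field) hoch \<Rightarrow> ('g, 'k) galg) \<Rightarrow> bool" where
  "kG_functional \<equiv> module_hom kG_scale (*)"

lemmas hom_iff = module_hom_iff eqTrueI[OF module_kG_scale] eqTrueI[OF module_kG]

lemma kG_linear_chain_lin:
  assumes "\<And>g xs. T g xs = kG_scale (gel g) (T 0 xs)"
  shows "kG_linear (chain_lin p T)"
proof -
  have "kG_scale (kG_scale a x xs) v = kG_scale a (kG_scale (x xs) v)" for a x xs and v :: "('a,'b) hoch"
    by (simp add: kG_scale_def mult_ac)
  then show ?thesis unfolding module_hom_iff chain_lin_eq[OF assms]
    by (simp add: module_kG_scale kG_scale_add_left sum.distrib kG_scale_sum)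
qed

lemma kG_linear_chain_lin_param:
  assumes "\<And>g xs. kG_linear (\<lambda>x. T x g xs)"
  shows "kG_linear (\<lambda>x. chain_lin p (T x) c)"
proof -
  have 1: "T (x + y) g xs = T x g xs + T y g xs" "T (kG_scale a x) g xs = kG_scale a (T x g xs)" for x y g xs a
    using assms[of g xs] by (auto simp: module_hom_iff)
  show ?thesis unfolding hom_iff chain_lin_def 1
    by (simp add: hoch_scal_eq kG_scale_add sum.distrib kG_scale_sum kG_scale_kG_scale mult_ac)
qed

lemma kG_linear_zero: "kG_linear (\<lambda>x. 0)" by (simp add: hom_iff)
lemma kG_linear_cochain: "(\<And>xs. kG_functional (\<lambda>x. F x xs)) \<Longrightarrow> kG_linear (\<lambda>x. cochain n (F x))"
  by (auto simp: hom_iff cochain_def fun_eq_iff kG_scale_def)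
lemma kG_linear_chain: "kG_functional a \<Longrightarrow> kG_linear (\<lambda>x. chain (a x) xs)"
  by (auto simp: hom_iff chain_def fun_eq_iff kG_scale_def)
lemma kG_linear_sum: "(\<And>i. kG_linear (F i)) \<Longrightarrow> kG_linear (\<lambda>x. \<Sum>i\<in>S. F i x)"
  by (simp add: hom_iff sum.distrib kG_scale_sum)
lemma kG_functional_sum: "(\<And>i. kG_functional (F i)) \<Longrightarrow> kG_functional (\<lambda>x. \<Sum>i\<in>S. F i x)"
  by (simp add: hom_iff sum.distrib sum_distrib_left)
lemma kG_linear_sgnp: "kG_linear F \<Longrightarrow> kG_linear (\<lambda>x. sgnp n (F x))"
  by (simp add: hom_iff sgnp_add kG_scale_sgnp)
lemma kG_functional_sgnp: "kG_functional F \<Longrightarrow> kG_functional (\<lambda>x. sgnp n (F x))"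
  by (simp add: hom_iff sgnp_add sgnp_mult)
lemma kG_functional_add: "kG_functional F \<Longrightarrow> kG_functional H \<Longrightarrow> kG_functional (\<lambda>x. F x + H x)"
  by (simp add: hom_iff algebra_simps)
lemma kG_functional_apply: "kG_functional (\<lambda>x. x xs)"
  by (simp add: hom_iff kG_scale_def)
lemma kG_functional_mult_left: "kG_functional F \<Longrightarrow> kG_functional (\<lambda>x. a * F x)"
  by (simp add: hom_iff algebra_simps)
lemma kG_functional_mult_right: "kG_functional F \<Longrightarrow> kG_functional (\<lambda>x. F x * a)"
  by (simp add: hom_iff algebra_simps)
lemma kG_linear_if: "(P \<Longrightarrow> kG_linear F) \<Longrightarrow> (\<not> P \<Longrightarrow> kG_linear H) \<Longrightarrow> kG_linear (\<lambda>x. if P then F x else H x)"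
  by (cases P) simp_all

text \<open>
  These rules follow the syntax of the defining formulas, so that linearity of an operation in one
  argument reduces to equivariance of the maps under each linear extension from basis chains.
\<close>

lemmas linear_intros = kG_linear_zero kG_linear_cochain kG_linear_chain kG_linear_sum
  kG_functional_sum kG_linear_sgnp kG_functional_sgnp
  kG_functional_add kG_functional_apply kG_functional_mult_left
  kG_functional_mult_right kG_linear_if kG_linear_chain_lin kG_linear_chain_lin_param

lemmas kG_simps = kG_scale_add kG_scale_sum kG_scale_sgnp kG_scale_chain kG_scale_cochain
  kG_scale_chain_lin sgnp_mult sum_distrib_left distrib_left mult_ac gel_add

text \<open>
  The cup product of two chains places \<open>g\<^sub>0\<close> inside the tuple, where \<open>kG\<close> does not visibly
  act.  The substitution \<open>g \<mapsto> g + g\<^sub>0\<close> in the sum over the group moves it to the first entry.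
\<close>

lemma sum_chain_shift:
  "(\<Sum>g\<in>UNIV. chain (gel (g + h)) (ys @ (- g + g0) # xs)) =
    (\<Sum>g\<in>UNIV. chain (gel g0 * (gel g * gel h)) (ys @ (- g) # xs) :: ('g::{ab_group_add,finite}, 'k::field) hoch)"
  by (rule sum.reindex_bij_witness[of _ "\<lambda>g. g + g0" "\<lambda>g. g - g0"])
     (simp_all add: mult_single algebra_simps)

lemma kG_linear_diff: "kG_linear (tate_diff n :: ('g::{ab_group_add,finite}, 'k::field) hoch \<Rightarrow> _)"
  unfolding tate_diff_def hoch_delta_def hoch_partial_def hoch_tau_def Let_def
  by (intro linear_intros) (simp_all add: kG_simps)

lemma kG_linear_cup_left: "kG_linear (\<lambda>x. tate_cup d e x (y :: ('g::{ab_group_add,finite}, 'k::field) hoch))"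
  unfolding tate_cup_def Let_def sum_chain_shift
  by (intro linear_intros) (simp_all add: kG_simps)

lemma kG_linear_cup_right: "kG_linear (\<lambda>y. tate_cup d e (x :: ('g::{ab_group_add,finite}, 'k::field) hoch) y)"
  unfolding tate_cup_def Let_def sum_chain_shift
  by (intro linear_intros) (simp_all add: kG_simps)

lemma kG_linear_m3_1: "kG_linear (\<lambda>x. tate_m3 d e f x (y :: ('g::{ab_group_add,finite}, 'k::field) hoch) z)"
  unfolding tate_m3_def Let_def
  by (intro linear_intros) (simp_all add: kG_simps)

lemma kG_linear_m3_2: "kG_linear (\<lambda>y. tate_m3 d e f (x :: ('g::{ab_group_add,finite}, 'k::field) hoch) y z)"
  unfolding tate_m3_def Let_def
  by (intro linear_intros) (simp_all add: kG_simps)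

lemma kG_linear_m3_3: "kG_linear (\<lambda>z. tate_m3 d e f (x :: ('g::{ab_group_add,finite}, 'k::field) hoch) y z)"
  unfolding tate_m3_def Let_def
  by (intro linear_intros) (simp_all add: kG_simps)

lemma kG_linear_oper: "kG_linear (\<lambda>x. tate_oper (us @ (n, x :: ('g::{ab_group_add,finite}, 'k::field) hoch) # ws))"
proof -
  consider "us = []" "ws = []" | d y where "us = []" "ws = [(d, y)]" | d y where "us = [(d, y)]" "ws = []"
    | d y e z where "us = []" "ws = [(d, y), (e, z)]"
    | d y e z where "us = [(d, y)]" "ws = [(e, z)]"
    | d y e z where "us = [(d, y), (e, z)]" "ws = []"
    | "3 \<le> length us + length ws"
    by (cases us rule: tate_oper.cases; cases ws rule: tate_oper.cases) auto
  then show ?thesis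
  proof cases
    case 7
    have "tate_oper xs = 0" if "4 \<le> length xs" for xs :: "(int \<times> ('g, 'k) hoch) list"
      using that by (cases xs rule: tate_oper.cases) auto
    with 7 show ?thesis by (simp add: kG_linear_zero)
  qed (simp_all add: kG_linear_diff kG_linear_cup_left kG_linear_cup_right kG_linear_m3_1 kG_linear_m3_2 kG_linear_m3_3)
qed

section \<open>The decomposition by weight\<close>

text \<open>
  The offset of weights: a coefficient at \<open>g\<close> over the tuple \<open>xs\<close> in degree \<open>n\<close> belongs to weight
  \<open>g - weight n xs\<close>.
\<close>

definition weight :: "int \<Rightarrow> 'g::ab_group_add list \<Rightarrow> 'g" where
  "weight n xs = (if 0 \<le> n then sum_list xs else - sum_list xs)"

lemma sum_list_neg_rev: "sum_list (map uminus (rev xs)) = - sum_list (xs :: 'g::ab_group_add list)"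
  by (induction xs) (simp_all add: algebra_simps)

lemma tate_embed_eq: "tate_embed n \<phi> = (\<lambda>xs. Poly_Mapping.single (weight n xs) (\<phi> xs))"
  by (simp add: tate_embed_def weight_def sum_list_neg_rev fun_eq_iff)

text \<open>
  The coefficient of \<open>weight_split n v\<close> at \<open>c\<close> is the component of \<open>v\<close> of weight \<open>c\<close>, shifted to
  weight zero and read as an element of the Tate complex of the group.
\<close>

definition weight_split :: "int \<Rightarrow> ('g::{ab_group_add,finite}, 'k::field) hoch \<Rightarrow> 'g \<Rightarrow>\<^sub>0 ('g, 'k) tate" where
  "weight_split n v = Abs_poly_mapping (\<lambda>c xs. Poly_Mapping.lookup (v xs) (c + weight n xs))"

definition weight_join :: "int \<Rightarrow> ('g::{ab_group_add,finite} \<Rightarrow>\<^sub>0 ('g, 'k::field) tate) \<Rightarrow> ('g, 'k) hoch" where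
  "weight_join n F = (\<Sum>c\<in>UNIV. kG_scale (gel c) (tate_embed n (Poly_Mapping.lookup F c)))"

lemma lookup_weight_split: "Poly_Mapping.lookup (weight_split n v) c xs = Poly_Mapping.lookup (v xs) (c + weight n xs)"
  by (simp add: weight_split_def)

lemma sum_fun_apply: "sum F S x = (\<Sum>i\<in>S. F i x)"
  by (induction S rule: infinite_finite_induct) auto

lemma lookup_weight_join: "Poly_Mapping.lookup (weight_join n F xs) g = Poly_Mapping.lookup F (g - weight n xs) xs"
proof -
  have "Poly_Mapping.lookup (weight_join n F xs) g =
      (\<Sum>c\<in>UNIV. if c = g - weight n xs then Poly_Mapping.lookup F c xs else 0)"
    unfolding weight_join_def sum_fun_apply lookup_sum
    by (rule sum.cong) (auto simp: kG_scale_def tate_embed_eq mult_single lookup_single when_def)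
  then show ?thesis by simp
qed

lemma weight_join_split [simp]: "weight_join n (weight_split n v) = v"
  by (rule ext, rule poly_mapping_eqI) (simp add: lookup_weight_join lookup_weight_split)

lemma weight_split_join [simp]: "weight_split n (weight_join n F) = F"
  by (rule poly_mapping_eqI, rule ext) (simp add: lookup_weight_join lookup_weight_split)

lemma weight_join_add: "weight_join n (F + H) = weight_join n F + weight_join n H"
  by (rule ext, rule poly_mapping_eqI) (simp add: lookup_weight_join lookup_add)

lemma weight_join_sum: "weight_join n (sum F S) = (\<Sum>i\<in>S. weight_join n (F i))"
proof -
  have "weight_join n 0 = 0" by (rule ext, rule poly_mapping_eqI) (simp add: lookup_weight_join)
  then show ?thesis using sum_comp_morphism[of "weight_join n" F S, symmetric] by (simp add: weight_join_add o_def)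
qed

lemma weight_join_single: "weight_join n (Poly_Mapping.single c \<phi>) = kG_scale (gel c) (tate_embed n \<phi>)"
  by (rule ext, rule poly_mapping_eqI)
     (auto simp: lookup_weight_join kG_scale_def tate_embed_eq mult_single lookup_single when_def)

lemma kG_linear_apply_sum: "kG_linear F \<Longrightarrow> F (sum f S) = (\<Sum>i\<in>S. F (f i))"
  using sum_comp_morphism[of F f S, symmetric] module_hom.zero[of kG_scale kG_scale F]
  by (simp add: module_hom_iff o_def)

lemma sum_lists_Suc:
  "(\<Sum>cs | length cs = Suc n. f cs) = (\<Sum>c\<in>UNIV. \<Sum>cs | length cs = n. f (c # cs :: 'g::finite list))"
proof -
  have "(\<Sum>cs | length cs = Suc n. f cs) = (\<Sum>(c, cs)\<in>UNIV \<times> {cs. length cs = n}. f (c # cs))"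
    by (rule sum.reindex_bij_witness[of _ "\<lambda>(c, cs). c # cs" "\<lambda>cs. (hd cs, tl cs)"])
       (auto simp: length_Suc_conv)
  then show ?thesis by (simp add: sum.cartesian_product)
qed

text \<open>
  The prefix \<open>us\<close> of arguments that are already decomposed lets the induction expand one slot
  after the other.
\<close>

lemma oper_expand:
  fixes us :: "(int \<times> ('g::{ab_group_add,finite}, 'k::field) hoch) list"
  shows "tate_oper (us @ map (\<lambda>(n, F). (n, weight_join n F)) zs) =
    (\<Sum>cs | length cs = length zs. kG_scale (gel (sum_list cs))
       (tate_oper (us @ map2 (\<lambda>c (n, F). (n, tate_embed n (Poly_Mapping.lookup F c))) cs zs)))"
proof (induction zs arbitrary: us)
  case Nil
  have "kG_scale 1 v = v" for v :: "('g, 'k) hoch" by (simp add: kG_scale_def)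
  then show ?case by simp
next
  case (Cons z zs)
  obtain n F where z: "z = (n, F)" by fastforce
  let ?ws = "map (\<lambda>(n, F). (n, weight_join n F)) zs"
  have "tate_oper (us @ (n, weight_join n F) # ?ws) =
      (\<Sum>c\<in>UNIV. kG_scale (gel c) (tate_oper ((us @ [(n, tate_embed n (Poly_Mapping.lookup F c))]) @ ?ws)))"
    unfolding weight_join_def[of n]
    using kG_linear_oper[of us n ?ws] by (simp add: kG_linear_apply_sum[OF kG_linear_oper] module_hom_iff)
  also have "\<dots> = (\<Sum>cs | length cs = Suc (length zs). kG_scale (gel (sum_list cs))
       (tate_oper (us @ map2 (\<lambda>c (n, F). (n, tate_embed n (Poly_Mapping.lookup F c))) cs ((n, F) # zs))))"
    unfolding Cons.IH sum_lists_Suc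
    by (simp add: kG_scale_sum kG_scale_kG_scale mult_single)
  finally show ?case by (simp add: z)
qed

section \<open>The operations preserve weight zero\<close>

text \<open>
  Membership is stated through the embedding because the operations on the Tate complex of the group
  are defined by inverting it on its image.
\<close>

definition weightless :: "int \<Rightarrow> ('g::ab_group_add, 'k::field) hoch set" where
  "weightless n = tate_embed n ` tate_comp n"

text \<open>
  The values of an element of weight zero are multiples of single group elements.  The existential
  form makes closure under the ring operations immediate.
\<close>

definition supported_at :: "'g \<Rightarrow> ('g, 'k::zero) galg \<Rightarrow> bool" where
  "supported_at g a \<longleftrightarrow> (\<exists>c. a = Poly_Mapping.single g c)"

lemma weightless_iff:
  "v \<in> weightless n \<longleftrightarrow> (\<forall>xs. xs \<notin> ntup (tdim n) \<longrightarrow> v xs = 0) \<and> (\<forall>xs. supported_at (weight n xs) (v xs))"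
proof
  assume "v \<in> weightless n"
  then show "(\<forall>xs. xs \<notin> ntup (tdim n) \<longrightarrow> v xs = 0) \<and> (\<forall>xs. supported_at (weight n xs) (v xs))"
    by (auto simp: weightless_def tate_comp_def tate_embed_eq supported_at_def)
next
  assume *: "(\<forall>xs. xs \<notin> ntup (tdim n) \<longrightarrow> v xs = 0) \<and> (\<forall>xs. supported_at (weight n xs) (v xs))"
  then obtain \<phi> where \<phi>: "v xs = Poly_Mapping.single (weight n xs) (\<phi> xs)" for xs
    unfolding supported_at_def by metis
  have "\<phi> xs = 0" if "xs \<notin> ntup (tdim n)" for xs
    using * that \<phi>[of xs] by (metis lookup_single_eq lookup_zero)
  with \<phi> show "v \<in> weightless n"
    unfolding weightless_def tate_comp_def tate_embed_eq by auto
qed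

lemma supported_at_zero: "supported_at g 0" unfolding supported_at_def by (metis single_zero)
lemma supported_at_add: "supported_at g a \<Longrightarrow> supported_at g b \<Longrightarrow> supported_at g (a + b)"
  unfolding supported_at_def by (metis single_add)
lemma supported_at_sum: "(\<And>i. i \<in> S \<Longrightarrow> supported_at g (F i)) \<Longrightarrow> supported_at g (sum F S)"
  by (induction S rule: infinite_finite_induct) (auto intro: supported_at_zero supported_at_add)
lemma supported_at_sgnp: "supported_at g (a :: ('g, 'k::field) galg) \<Longrightarrow> supported_at g (sgnp n a)"
  unfolding supported_at_def sgnp_def by (metis single_uminus)
lemma supported_at_single: "g = h \<Longrightarrow> supported_at g (Poly_Mapping.single h c)"
  unfolding supported_at_def by auto
lemma supported_at_mult: "supported_at g a \<Longrightarrow> supported_at h b \<Longrightarrow> supported_at (g + h) (a * b)"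
  unfolding supported_at_def by (metis mult_single)
lemma supported_at_mult_eq: "supported_at h a \<Longrightarrow> supported_at l b \<Longrightarrow> h + l = g \<Longrightarrow> supported_at g (a * b)"
  using supported_at_mult by blast

lemma weightless_zero: "0 \<in> weightless n"
  by (simp add: weightless_iff supported_at_zero)
lemma weightless_add: "v \<in> weightless n \<Longrightarrow> w \<in> weightless n \<Longrightarrow> v + w \<in> weightless n"
  by (simp add: weightless_iff supported_at_add)
lemma weightless_sum: "(\<And>i. i \<in> S \<Longrightarrow> F i \<in> weightless n) \<Longrightarrow> sum F S \<in> weightless n"
  by (induction S rule: infinite_finite_induct) (auto intro: weightless_zero weightless_add)
lemma weightless_sgnp: "v \<in> weightless n \<Longrightarrow> sgnp i v \<in> weightless n"
  by (simp add: weightless_iff sgnp_apply supported_at_sgnp)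

lemma weightless_cochain:
  assumes "0 \<le> n" "p = nat n" "\<And>xs. length xs = p \<Longrightarrow> supported_at (sum_list xs) (F xs)"
  shows "cochain p F \<in> weightless n"
  using assms by (auto simp: weightless_iff cochain_def tdim_def weight_def ntup_def supported_at_zero)

lemma weightless_chain:
  assumes "n < 0" "int (length xs) = - n - 1" "supported_at (- sum_list xs) a"
  shows "chain a xs \<in> weightless n"
  using assms by (auto simp: weightless_iff chain_def tdim_def weight_def ntup_def supported_at_zero)

lemma supported_at_scale: "supported_at g a \<Longrightarrow> supported_at (g :: 'g::ab_group_add) (Poly_Mapping.single 0 c * a)"
  by (rule supported_at_mult_eq[OF supported_at_single[OF refl]], assumption, simp)

lemma weightless_hoch_scal:
  fixes v :: "('g::{ab_group_add,finite}, 'k::field) hoch"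
  shows "v \<in> weightless n \<Longrightarrow> hoch_scal c v \<in> weightless n"
  by (simp add: weightless_iff hoch_scal_eq kG_scale_def supported_at_scale)

text \<open>
  In an element of weight zero only the basis chain \<open>(- sum_list xs, xs)\<close> over each tuple \<open>xs\<close>
  can occur.
\<close>

lemma weightless_chain_lin:
  assumes "c \<in> weightless e" "e < 0" "p = tdim e"
    and "\<And>xs. length xs = p \<Longrightarrow> T (- sum_list xs) xs \<in> weightless n"
  shows "chain_lin p T c \<in> weightless n"
  unfolding chain_lin_def
proof (intro weightless_sum)
  fix xs :: "'a list" and g :: 'a assume xs: "xs \<in> ntup p"
  show "hoch_scal (Poly_Mapping.lookup (c xs) g) (T g xs) \<in> weightless n"
  proof (cases "g = - sum_list xs")
    case True
    with assms xs show ?thesis by (auto intro: weightless_hoch_scal simp: ntup_def)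
  next
    case False
    from assms(1,2) obtain d where "c xs = Poly_Mapping.single (- sum_list xs) d"
      by (auto simp: weightless_iff weight_def supported_at_def)
    with False have "Poly_Mapping.lookup (c xs) g = 0" by (simp add: lookup_single)
    then show ?thesis by (simp add: hoch_scal_eq kG_scale_zero_left weightless_zero)
  qed
qed

lemma supported_at_value: "v \<in> weightless n \<Longrightarrow> 0 \<le> n \<Longrightarrow> sum_list xs = g \<Longrightarrow> supported_at g (v xs)"
  by (auto simp: weightless_iff weight_def)

text \<open>
  These rules have no unknowns in their premises once the conclusion is matched, which makes the
  group element at which a product must be supported computable factor by factor.
\<close>

lemma supported_at_gel_mult: "supported_at (g - h) a \<Longrightarrow> supported_at (g :: 'g::ab_group_add) (gel h * a)"
  by (rule supported_at_mult_eq[OF supported_at_single[OF refl]], assumption, simp)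
lemma supported_at_mult_gel: "supported_at (g - h) a \<Longrightarrow> supported_at (g :: 'g::ab_group_add) (a * gel h)"
  by (rule supported_at_mult_eq[OF _ supported_at_single[OF refl]], assumption, simp)
lemma supported_at_value_mult:
  "v \<in> weightless n \<Longrightarrow> 0 \<le> n \<Longrightarrow> supported_at (g - sum_list xs) a \<Longrightarrow> supported_at g (v xs * a)"
  by (rule supported_at_mult_eq[OF supported_at_value[OF _ _ refl]], assumption+, simp)
lemma supported_at_mult_value:
  "v \<in> weightless n \<Longrightarrow> 0 \<le> n \<Longrightarrow> supported_at (g - sum_list xs) a \<Longrightarrow> supported_at g (a * v xs)"
  by (rule supported_at_mult_eq[OF _ supported_at_value[OF _ _ refl]], assumption+, simp)

lemma sum_list_drop: "sum_list (drop n xs) = sum_list xs - sum_list (take n xs :: 'g::ab_group_add list)"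
  by (metis add_diff_cancel_left' append_take_drop_id sum_list_append)

lemma sum_list_tl: "xs \<noteq> [] \<Longrightarrow> sum_list (tl xs) = sum_list xs - (hd xs :: 'g::ab_group_add)"
  by (cases xs) simp_all

lemma sum_list_butlast: "xs \<noteq> [] \<Longrightarrow> sum_list (butlast xs) = sum_list xs - (last xs :: 'g::ab_group_add)"
  by (cases xs rule: rev_cases) simp_all

lemma sum_list_merge:
  assumes "1 \<le> i" "i < length xs"
  shows "sum_list (merge i xs) = sum_list (xs :: 'g::ab_group_add list)"
proof -
  from assms have "xs = take (i - 1) xs @ xs ! (i - 1) # xs ! i # drop (i + 1) xs"
    by (metis Cons_nth_drop_Suc Suc_eq_plus1 add.commute id_take_nth_drop le_add_diff_inverse less_imp_diff_less plus_1_eq_Suc)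
  then have "sum_list xs = sum_list (take (i - 1) xs @ xs ! (i - 1) # xs ! i # drop (i + 1) xs)"
    by simp
  then show ?thesis by (simp add: merge_def add_ac)
qed

lemma length_merge: "1 \<le> i \<Longrightarrow> i < length xs \<Longrightarrow> length (merge i xs) = length xs - 1"
  by (simp add: merge_def)

lemmas weightless_intros = weightless_cochain weightless_sum weightless_sgnp weightless_add weightless_zero
  supported_at_sum supported_at_sgnp supported_at_add

lemmas sum_list_cut = sum_list_drop sum_list_tl sum_list_butlast sum_list_merge length_merge

text \<open>
  The faces of a tuple multiply neighbouring entries, cyclically for chains, or turn an end entry
  into a factor of the value: the sum that defines the weight does not change.
\<close>

lemma weightless_diff:
  fixes v :: "('g::{ab_group_add,finite}, 'k::field) hoch"
  assumes v: "v \<in> weightless n"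
  shows "tate_diff n v \<in> weightless (n + 1)"
proof -
  consider "0 \<le> n" | "n = - 1" | "n < - 1" by linarith
  then show ?thesis
  proof cases
    case 1
    have "hoch_delta (nat n) v \<in> weightless (n + 1)"
      unfolding hoch_delta_def
    proof (intro weightless_intros)
      fix xs :: "'g list" assume xs: "length xs = nat n + 1"
      then have "xs \<noteq> []" by auto
      then show "supported_at (sum_list xs) (gel (hd xs) * v (tl xs))"
        and "supported_at (sum_list xs) (v (butlast xs) * gel (last xs))"
        by (auto intro!: supported_at_gel_mult supported_at_mult_gel supported_at_value[OF v 1] simp: sum_list_cut)
      fix i assume "i \<in> {1..nat n}"
      with xs show "supported_at (sum_list xs) (v (merge i xs))"
        by (intro supported_at_value[OF v 1] sum_list_merge) auto
    qed (use 1 in auto)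
    with 1 show ?thesis by (simp add: tate_diff_def tdim_def)
  next
    case 2
    have "hoch_tau v \<in> weightless 0"
      unfolding hoch_tau_def
      by (intro weightless_chain_lin[OF v] weightless_intros supported_at_single)
         (use 2 in \<open>auto simp: tdim_def\<close>)
    with 2 show ?thesis by (simp add: tate_diff_def)
  next
    case 3
    have "hoch_partial (tdim n) v \<in> weightless (n + 1)"
      unfolding hoch_partial_def
    proof (rule weightless_chain_lin[OF v])
      fix xs :: "'g list" assume xs: "length xs = tdim n"
      with 3 have "xs \<noteq> []" "int (length xs) = - n - 1" by (auto simp: tdim_def)
      with 3 xs show "chain (gel (- sum_list xs + hd xs)) (tl xs)
        + (\<Sum>i = 1..<tdim n. sgnp (int i) (chain (gel (- sum_list xs)) (merge i xs)))
        + sgnp (int (tdim n)) (chain (gel (last xs + - sum_list xs)) (butlast xs)) \<in> weightless (n + 1)"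
        by (intro weightless_intros weightless_chain supported_at_single)
           (auto simp: sum_list_cut of_nat_diff Suc_le_eq)
    qed (use 3 in auto)
    with 3 show ?thesis by (simp add: tate_diff_def weightless_sgnp)
  qed
qed

text \<open>
  Concatenating and cutting tuples only redistributes entries between the tuples and the values; the
  summation variable \<open>g\<close> enters once with each sign and cancels.
\<close>

lemma weightless_cup:
  fixes v :: "('g::{ab_group_add,finite}, 'k::field) hoch"
  assumes v: "v \<in> weightless n" and w: "w \<in> weightless m"
  shows "tate_cup n m v w \<in> weightless (n + m)"
proof -
  consider "0 \<le> n" "0 \<le> m" | "n < 0" "m < 0" | "0 \<le> n" "m < 0" | "n < 0" "0 \<le> m" by linarith
  then show ?thesis
  proof cases
    case 1
    have "cochain (tdim n + tdim m) (\<lambda>xs. v (take (tdim n) xs) * w (drop (tdim n) xs)) \<in> weightless (n + m)"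
      by (intro weightless_intros supported_at_value_mult[OF v] supported_at_value[OF w])
         (use 1 in \<open>auto simp: tdim_def sum_list_cut nat_add_distrib\<close>)
    with 1 show ?thesis by (simp add: tate_cup_def Let_def)
  next
    case 2
    have "chain_lin (tdim n) (\<lambda>g0 xs. chain_lin (tdim m) (\<lambda>h0 ys.
         \<Sum>g\<in>UNIV. chain (gel (g + h0)) (ys @ (- g + g0) # xs)) w) v \<in> weightless (n + m)"
      by (intro weightless_chain_lin[OF v] weightless_chain_lin[OF w] weightless_sum weightless_chain supported_at_single)
         (use 2 in \<open>auto simp: tdim_def\<close>)
    with 2 show ?thesis by (simp add: tate_cup_def Let_def)
  next
    case 3
    let ?n = "tdim n" and ?m = "tdim m"
    have "chain_lin ?m (\<lambda>h0 ys. if ?n \<le> ?m then chain (v (drop (?m - ?n) ys) * gel h0) (take (?m - ?n) ys)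
         else cochain (?n - ?m - 1) (\<lambda>hs. \<Sum>g\<in>UNIV. v (hs @ (- g) # ys) * gel h0 * gel g)) w
       \<in> weightless (n + m)"
    proof (intro weightless_chain_lin[OF w])
      fix ys :: "'g list" assume ys: "length ys = ?m"
      show "(if ?n \<le> ?m then chain (v (drop (?m - ?n) ys) * gel (- sum_list ys)) (take (?m - ?n) ys)
         else cochain (?n - ?m - 1) (\<lambda>hs. \<Sum>g\<in>UNIV. v (hs @ (- g) # ys) * gel (- sum_list ys) * gel g))
       \<in> weightless (n + m)"
      proof (cases "?n \<le> ?m")
        case True
        have "chain (v (drop (?m - ?n) ys) * gel (- sum_list ys)) (take (?m - ?n) ys) \<in> weightless (n + m)"
          by (intro weightless_chain supported_at_mult_gel supported_at_value[OF v])
             (use True 3 ys in \<open>auto simp: tdim_def sum_list_cut\<close>)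
        with True show ?thesis by simp
      next
        case False
        have "cochain (?n - ?m - 1) (\<lambda>hs. \<Sum>g\<in>UNIV. v (hs @ (- g) # ys) * gel (- sum_list ys) * gel g)
           \<in> weightless (n + m)"
          by (intro weightless_intros supported_at_mult_gel supported_at_value[OF v])
             (use False 3 in \<open>auto simp: tdim_def\<close>)
        with False show ?thesis by simp
      qed
    qed (use 3 in auto)
    with 3 show ?thesis by (simp add: tate_cup_def Let_def)
  next
    case 4
    let ?n = "tdim n" and ?m = "tdim m"
    have "chain_lin ?n (\<lambda>g0 xs. if ?m \<le> ?n then chain (gel g0 * w (take ?m xs)) (drop ?m xs)
         else cochain (?m - ?n - 1) (\<lambda>hs. \<Sum>g\<in>UNIV. gel g * gel g0 * w (xs @ (- g) # hs))) v
       \<in> weightless (n + m)"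
    proof (intro weightless_chain_lin[OF v])
      fix xs :: "'g list" assume xs: "length xs = ?n"
      show "(if ?m \<le> ?n then chain (gel (- sum_list xs) * w (take ?m xs)) (drop ?m xs)
         else cochain (?m - ?n - 1) (\<lambda>hs. \<Sum>g\<in>UNIV. gel g * gel (- sum_list xs) * w (xs @ (- g) # hs)))
       \<in> weightless (n + m)"
      proof (cases "?m \<le> ?n")
        case True
        have "chain (gel (- sum_list xs) * w (take ?m xs)) (drop ?m xs) \<in> weightless (n + m)"
          by (intro weightless_chain supported_at_gel_mult supported_at_value[OF w])
             (use True 4 xs in \<open>auto simp: tdim_def sum_list_cut\<close>)
        with True show ?thesis by simp
      next
        case False
        have "cochain (?m - ?n - 1) (\<lambda>hs. \<Sum>g\<in>UNIV. gel g * gel (- sum_list xs) * w (xs @ (- g) # hs))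
           \<in> weightless (n + m)"
          by (intro weightless_intros supported_at_mult_value[OF w] supported_at_gel_mult supported_at_single)
             (use False 4 in \<open>auto simp: tdim_def\<close>)
        with False show ?thesis by simp
      qed
    qed (use 4 in auto)
    with 4 show ?thesis by (simp add: tate_cup_def Let_def)
  qed
qed

text \<open>
  As for the cup product: the two tuples are cut and reassembled around one inserted pair \<open>g\<close>,
  \<open>- g\<close>.
\<close>

lemma weightless_m3:
  fixes v :: "('g::{ab_group_add,finite}, 'k::field) hoch"
  assumes u: "u \<in> weightless d" and v: "v \<in> weightless e" and w: "w \<in> weightless f"
  shows "tate_m3 d e f u v w \<in> weightless (d + e + f - 1)"
proof -
  consider "0 \<le> d" "e < 0" "0 \<le> f" | "d < 0" "0 \<le> e" "f < 0"
    | "\<not> (0 \<le> d \<and> e < 0 \<and> 0 \<le> f)" "\<not> (d < 0 \<and> 0 \<le> e \<and> f < 0)" by linarith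
  then show ?thesis
  proof cases
    case 1
    let ?m = "tdim d" and ?r = "tdim e" and ?n = "tdim f"
    have "chain_lin ?r (\<lambda>g0 xs. cochain (?m + ?n - ?r - 2) (\<lambda>hs.
        \<Sum>g\<in>UNIV. \<Sum>j | 1 \<le> j \<and> j \<le> min ?n (?r + 1) \<and> ?r + 2 \<le> ?m + j.
          sgnp (int ?m + int ?r + int j - 1)
            (u (take (?m + j - ?r - 2) hs @ g # drop (j - 1) xs) * gel g0
              * w (take (j - 1) xs @ (- g) # drop (?m + j - ?r - 2) hs)))) v
       \<in> weightless (d + e + f - 1)" if "?r + 2 \<le> ?m + ?n"
      by (intro weightless_chain_lin[OF v] weightless_intros supported_at_mult_value[OF w] supported_at_mult_gel
            supported_at_value[OF u])
         (use 1 that in \<open>auto simp: tdim_def sum_list_cut\<close>)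
    with 1 show ?thesis by (simp add: tate_m3_def Let_def weightless_zero)
  next
    case 2
    let ?r = "tdim d" and ?m = "tdim e" and ?s = "tdim f"
    have "chain_lin ?r (\<lambda>g0 xs. chain_lin ?s (\<lambda>h0 ys.
        \<Sum>g\<in>UNIV. \<Sum>j | j \<le> ?s \<and> ?s + 1 \<le> ?m + j \<and> ?m + j - ?s - 1 \<le> ?r.
          sgnp (int ?r + int ?s + int ?m - int j)
            (chain (gel g0 * v (take (?m + j - ?s - 1) xs @ g # drop j ys) * gel h0)
              (take j ys @ (- g) # drop (?m + j - ?s - 1) xs))) w) u
       \<in> weightless (d + e + f - 1)"
      by (intro weightless_chain_lin[OF u] weightless_chain_lin[OF w] weightless_intros weightless_chain
            supported_at_mult_gel supported_at_gel_mult supported_at_value[OF v])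
         (use 2 in \<open>auto simp: tdim_def sum_list_cut, linarith\<close>)
    with 2 show ?thesis by (simp add: tate_m3_def Let_def weightless_zero)
  next
    case 3
    then show ?thesis by (auto simp: tate_m3_def weightless_zero)
  qed
qed

lemma weightless_oper:
  fixes xs :: "(int \<times> ('g::{ab_group_add,finite}, 'k::field) hoch) list"
  assumes "\<forall>(n, x) \<in> set xs. x \<in> weightless n"
  shows "tate_oper xs \<in> weightless (out_deg xs)"
  using assms weightless_diff weightless_cup weightless_m3
  by (cases xs rule: tate_oper.cases)
     (auto simp: out_deg_def total_deg_def weightless_zero algebra_simps)

section \<open>The isomorphism\<close>

lemma tate_embed_inv:
  assumes "v \<in> weightless n"
  shows "tate_embed n (inv_into (tate_comp n) (tate_embed n) v) = v"
  using assms unfolding weightless_def by (rule f_inv_into_f)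

lemma hoch_piece: "v \<in> piece (tate_hochschild TYPE('k::field) TYPE('g::{group_add,finite})) n \<longleftrightarrow>
    (\<forall>xs. xs \<notin> ntup (tdim n) \<longrightarrow> v xs = 0)"
  by (simp add: tate_hochschild_def)

lemma tensor_piece:
  "F \<in> piece (galg_tensor TYPE('g) (tate_group TYPE('k::field) TYPE('g::{ab_group_add,finite}))) n \<longleftrightarrow>
    (\<forall>c. Poly_Mapping.lookup F c \<in> tate_comp n)"
  by (simp add: galg_tensor_def tate_group_def)

lemma weight_split_piece:
  fixes v :: "('g::{ab_group_add,finite}, 'k::field) hoch"
  assumes "v \<in> piece (tate_hochschild TYPE('k) TYPE('g)) n"
  shows "weight_split n v \<in> piece (galg_tensor TYPE('g) (tate_group TYPE('k) TYPE('g))) n"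
  using assms by (simp add: hoch_piece tensor_piece tate_comp_def lookup_weight_split)

lemma weight_join_piece:
  fixes F :: "'g::{ab_group_add,finite} \<Rightarrow>\<^sub>0 ('g, 'k::field) tate"
  assumes "F \<in> piece (galg_tensor TYPE('g) (tate_group TYPE('k) TYPE('g))) n"
  shows "weight_join n F \<in> piece (tate_hochschild TYPE('k) TYPE('g)) n"
  using assms by (auto simp: hoch_piece tensor_piece tate_comp_def intro!: poly_mapping_eqI simp: lookup_weight_join)

lemma weight_split_add: "weight_split n (v + w) = weight_split n v + weight_split n w"
  by (rule poly_mapping_eqI, rule ext) (simp add: lookup_weight_split lookup_add)

lemma weight_split_scal:
  "weight_split n (hoch_scal c v) = scal (galg_tensor TYPE('g) (tate_group TYPE('k) TYPE('g))) c
     (weight_split n (v :: ('g::{ab_group_add,finite}, 'k::field) hoch))"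
  by (rule poly_mapping_eqI, rule ext)
     (auto simp: galg_tensor_def tate_group_def map.rep_eq when_def lookup_weight_split hoch_scal_def,
      metis lookup_weight_split zero_fun_apply)

text \<open>
  The operation on the tensor product sums over all choices of one weight per argument.  Applying
  \<open>weight_join\<close> turns each summand into an operation on elements of weight zero, shifted by the
  total weight, and the sum is the multilinear expansion of the operation on the original list.
\<close>

lemma weight_split_oper:
  fixes xs :: "(int \<times> ('g::{ab_group_add,finite}, 'k::field) hoch) list"
  assumes "homogeneous (tate_hochschild TYPE('k) TYPE('g)) xs"
  shows "weight_split (out_deg xs) (tate_oper xs) =
    oper (galg_tensor TYPE('g) (tate_group TYPE('k) TYPE('g))) (map (\<lambda>(n, x). (n, weight_split n x)) xs)"
proof -
  define zs where "zs = map (\<lambda>(n, x). (n, weight_split n x)) xs"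
  \<comment> \<open>For each choice \<open>cs\<close> of weights, the list of components of these weights.\<close>
  define pick where "pick cs = map2 (\<lambda>c (n, F). (n, Poly_Mapping.lookup F c)) cs zs" for cs
  have xs: "xs = map (\<lambda>(n, F). (n, weight_join n F)) zs"
    by (simp add: zs_def map_idI split_beta o_def)
  have emb: "map (\<lambda>(n, \<phi>). (n, tate_embed n \<phi>)) (pick cs)
      = map2 (\<lambda>c (n, F). (n, tate_embed n (Poly_Mapping.lookup F c))) cs zs" for cs
    by (simp add: pick_def split_beta o_def)
  have piece: "F \<in> piece (galg_tensor TYPE('g) (tate_group TYPE('k) TYPE('g))) n" if "(n, F) \<in> set zs" for n F
    using that assms by (auto simp: zs_def homogeneous_def intro!: weight_split_piece)
  have closed: "tate_oper (map (\<lambda>(n, \<phi>). (n, tate_embed n \<phi>)) (pick cs)) \<in> weightless (out_deg xs)"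
    if "length cs = length zs" for cs
  proof -
    have "out_deg (map2 (\<lambda>c (n, F). (n, tate_embed n (Poly_Mapping.lookup F c))) cs zs) = out_deg xs"
    proof -
      have "map fst (map2 (\<lambda>c (n, F). (n, tate_embed n (Poly_Mapping.lookup F c))) cs zs) = map fst zs"
        using that by (induction cs zs rule: list_induct2) auto
      then show ?thesis using that by (simp add: out_deg_def total_deg_def zs_def o_def split_beta)
    qed
    moreover have "tate_embed n (Poly_Mapping.lookup F c) \<in> weightless n" if "(n, F) \<in> set zs" for n F c
      using piece[OF that] by (auto simp: weightless_def tensor_piece)
    ultimately show ?thesis
      unfolding emb using weightless_oper[of "map2 (\<lambda>c (n, F). (n, tate_embed n (Poly_Mapping.lookup F c))) cs zs"]
      by (fastforce dest: set_zip_rightD)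
  qed
  have out: "out_deg (pick cs) = out_deg xs" if "length cs = length zs" for cs
  proof -
    have "map fst (pick cs) = map fst zs"
      unfolding pick_def using that by (induction cs zs rule: list_induct2) auto
    then show ?thesis using that by (simp add: out_deg_def total_deg_def zs_def o_def split_beta pick_def)
  qed
  have "weight_join (out_deg xs) (oper (galg_tensor TYPE('g) (tate_group TYPE('k) TYPE('g))) zs) =
      (\<Sum>cs | length cs = length zs. kG_scale (gel (sum_list cs))
        (tate_embed (out_deg xs) (oper (tate_group TYPE('k) TYPE('g)) (pick cs))))"
    by (simp add: galg_tensor_def weight_join_sum weight_join_single pick_def)
  also have "\<dots> = (\<Sum>cs | length cs = length zs. kG_scale (gel (sum_list cs))
        (tate_oper (map (\<lambda>(n, \<phi>). (n, tate_embed n \<phi>)) (pick cs))))"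
    using tate_embed_inv[OF closed] out by (simp add: tate_group_def)
  also have "\<dots> = tate_oper xs"
    unfolding emb using oper_expand[of "[]" zs] by (simp add: xs[symmetric])
  finally show ?thesis
    unfolding zs_def[symmetric] by (metis weight_split_join)
qed

lemma galg_form_gel: "galg_form a (gel g) = Poly_Mapping.lookup a (- g)"
proof -
  have "(\<Sum>l\<in>UNIV. Poly_Mapping.lookup a h * Poly_Mapping.lookup (gel g) l * (if h + l = 0 then 1 else 0))
      = (if h = - g then Poly_Mapping.lookup a h else 0)" for h
  proof -
    have "Poly_Mapping.lookup a h * Poly_Mapping.lookup (gel g) l * (if h + l = 0 then 1 else 0)
        = (if l = g then if h = - g then Poly_Mapping.lookup a h else 0 else 0)" for l
      by (auto simp: lookup_single when_def eq_neg_iff_add_eq_0)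
    then show ?thesis by simp
  qed
  then show ?thesis unfolding galg_form_def by simp
qed

text \<open>
  The sum over \<open>g\<close> is the coefficient of the product \<open>\<alpha> xs * \<beta> xs\<close> at the unit; in this form the
  pairing is visibly symmetric.
\<close>

definition pairing :: "nat \<Rightarrow> ('g::{ab_group_add,finite}, 'k::field) hoch \<Rightarrow> ('g, 'k) hoch \<Rightarrow> 'k" where
  "pairing p \<alpha> \<beta> = (\<Sum>xs\<in>ntup p. \<Sum>g\<in>UNIV. Poly_Mapping.lookup (\<beta> xs) g * Poly_Mapping.lookup (\<alpha> xs) (- g))"

lemma tate_form_eq:
  "tate_form (m, v) (n, w) =
    (if 0 \<le> m \<and> n < 0 \<and> tdim m = tdim n \<or> m < 0 \<and> 0 \<le> n \<and> tdim m = tdim n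
     then pairing (tdim m) v w else 0)"
proof -
  have "pairing p \<beta> \<alpha> = pairing p \<alpha> \<beta>" for p and \<alpha> \<beta> :: "('b, 'a) hoch"
    unfolding pairing_def
    by (intro sum.cong refl sum.reindex_bij_witness[of _ uminus uminus]) (simp_all add: mult.commute)
  then show ?thesis
    by (simp add: tate_form_def galg_form_gel pairing_def[symmetric])
qed

text \<open>
  A cochain and a chain have opposite offsets, so the components of weights \<open>g\<close> and \<open>h\<close> contribute
  over \<open>xs\<close> the product of a coefficient at \<open>g + weight m xs\<close> and one at \<open>h - weight m xs\<close>.  For
  \<open>h = - g\<close> these positions are opposite, and as \<open>g\<close> runs over the group all opposite pairs occur.
\<close>

lemma pairing_weight_split:
  assumes "\<And>xs. weight n xs = - weight m (xs :: 'g list)"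
  shows "(\<Sum>g\<in>UNIV. \<Sum>h\<in>UNIV. (if g + h = 0 then 1 else 0) *
      pairing p (tate_embed m (Poly_Mapping.lookup (weight_split m v) g))
        (tate_embed n (Poly_Mapping.lookup (weight_split n w) h))) =
      pairing p v (w :: ('g::{ab_group_add,finite}, 'k::field) hoch)"
proof -
  have 1: "(\<Sum>h\<in>UNIV. (if g + h = 0 then 1 else 0) * f h) = f (- g)" for f :: "'g \<Rightarrow> 'k" and g
  proof -
    have "(\<Sum>h\<in>UNIV. (if g + h = 0 then 1 else 0) * f h) = (\<Sum>h\<in>UNIV. if h = - g then f h else 0)"
      by (rule sum.cong) (auto simp: eq_neg_iff_add_eq_0 add.commute)
    then show ?thesis by simp
  qed
  have 2: "(\<Sum>h\<in>UNIV. Poly_Mapping.lookup (tate_embed n (Poly_Mapping.lookup (weight_split n w) (- g)) xs) h *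
      Poly_Mapping.lookup (tate_embed m (Poly_Mapping.lookup (weight_split m v) g) xs) (- h)) =
      Poly_Mapping.lookup (w xs) (- (g + weight m xs)) * Poly_Mapping.lookup (v xs) (g + weight m xs)"
    (is "(\<Sum>h\<in>UNIV. ?F h) = ?r") for g xs
  proof -
    have "?F h = (if h = - weight m xs then ?r else 0)" for h
      by (auto simp: tate_embed_eq lookup_weight_split lookup_single when_def assms)
    then show ?thesis by simp
  qed
  have 3: "(\<Sum>g\<in>UNIV. f (- (g + weight m xs)) * f' (g + weight m xs)) = (\<Sum>g\<in>UNIV. f g * f' (- g))"
    for f f' :: "'g \<Rightarrow> 'k" and xs :: "'g list"
    by (rule sum.reindex_bij_witness[of _ "\<lambda>g. - g - weight m xs" "\<lambda>g. - (g + weight m xs)"]) (simp_all add: add.commute)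
  have "(\<Sum>g\<in>UNIV. \<Sum>xs\<in>ntup p. Poly_Mapping.lookup (w xs) (- (g + weight m xs)) * Poly_Mapping.lookup (v xs) (g + weight m xs))
      = pairing p v w"
    unfolding pairing_def by (subst sum.swap) (simp only: 3)
  then show ?thesis
    by (simp only: 1 pairing_def 2)
qed

lemma weight_split_form:
  fixes v w :: "('g::{ab_group_add,finite}, 'k::field) hoch"
  shows "form (galg_tensor TYPE('g) (tate_group TYPE('k) TYPE('g))) (m, weight_split m v) (n, weight_split n w) =
    tate_form (m, v) (n, w)"
proof (cases "0 \<le> m \<and> n < 0 \<and> tdim m = tdim n \<or> m < 0 \<and> 0 \<le> n \<and> tdim m = tdim n")
  case True
  then have "weight n xs = - weight m xs" for xs :: "'g list" by (auto simp: weight_def)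
  from pairing_weight_split[OF this] True show ?thesis
    by (simp add: galg_tensor_def tate_group_def tate_form_eq galg_form_gel lookup_single when_def eq_neg_iff_add_eq_0)
next
  case False
  then show ?thesis by (simp only: galg_tensor_def tate_group_def tate_form_eq) auto
qed

theorem weight_split_iso:
  "cyclic_Ainf_iso (tate_hochschild TYPE('k::field) TYPE('g::{ab_group_add, finite}))
     (galg_tensor TYPE('g) (tate_group TYPE('k) TYPE('g))) weight_split"
  unfolding cyclic_Ainf_iso_def
proof (intro conjI allI ballI impI)
  fix n
  show "bij_betw (weight_split n) (piece (tate_hochschild TYPE('k) TYPE('g)) n)
      (piece (galg_tensor TYPE('g) (tate_group TYPE('k) TYPE('g))) n)"
    by (rule bij_betw_byWitness[of _ "weight_join n"]) (auto intro: weight_split_piece weight_join_piece)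
next
  fix n :: int and c and x y :: "('g, 'k) hoch"
  show "weight_split n (x + y) = weight_split n x + weight_split n y" by (rule weight_split_add)
  show "weight_split n (scal (tate_hochschild TYPE('k) TYPE('g)) c x) =
      scal (galg_tensor TYPE('g) (tate_group TYPE('k) TYPE('g))) c (weight_split n x)"
    unfolding weight_split_scal[symmetric] by (simp add: tate_hochschild_def)
next
  fix xs :: "(int \<times> ('g, 'k) hoch) list"
  assume "xs \<noteq> [] \<and> homogeneous (tate_hochschild TYPE('k) TYPE('g)) xs"
  then show "weight_split (out_deg xs) (oper (tate_hochschild TYPE('k) TYPE('g)) xs) =
      oper (galg_tensor TYPE('g) (tate_group TYPE('k) TYPE('g))) (map (\<lambda>(n, x). (n, weight_split n x)) xs)"
    using weight_split_oper[of xs] by (simp add: tate_hochschild_def)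
next
  fix m n :: int and x y :: "('g, 'k) hoch"
  show "form (galg_tensor TYPE('g) (tate_group TYPE('k) TYPE('g))) (m, weight_split m x) (n, weight_split n y) =
      form (tate_hochschild TYPE('k) TYPE('g)) (m, x) (n, y)"
    unfolding weight_split_form by (simp add: tate_hochschild_def)
qed

lemma graded_tensor:
  "graded_space (galg_tensor TYPE('g) (tate_group TYPE('k::field) TYPE('g::{ab_group_add, finite})))"
proof -
  let ?s = "scal (galg_tensor TYPE('g) (tate_group TYPE('k) TYPE('g)))"
  have s: "Poly_Mapping.lookup (?s c F) g xs = c * Poly_Mapping.lookup F g xs" for c F g xs
    by (simp add: galg_tensor_def tate_group_def map.rep_eq when_def)
  have vs: "vector_space ?s"
    by unfold_locales (simp_all add: poly_mapping_eq_iff fun_eq_iff s lookup_add algebra_simps)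
  then have "module ?s" by (simp add: module_iff_vector_space)
  then show ?thesis unfolding graded_space_def
    using vs by (auto simp: module.subspace_def tensor_piece tate_comp_def s lookup_add)
qed

theorem corollary4p11:
  shows "(\<exists>f. cyclic_Ainf_iso
            (tate_hochschild TYPE('k::field) TYPE('g::{ab_group_add, finite}))
            (galg_tensor TYPE('g) (tate_group TYPE('k) TYPE('g))) f) \<and>
         (cyclic_Ainf (tate_hochschild TYPE('k) TYPE('g)) \<longrightarrow>
            cyclic_Ainf (galg_tensor TYPE('g) (tate_group TYPE('k) TYPE('g))))"
proof (intro conjI impI)
  show "\<exists>f. cyclic_Ainf_iso (tate_hochschild TYPE('k) TYPE('g))
      (galg_tensor TYPE('g) (tate_group TYPE('k) TYPE('g))) f"
    by (rule exI, rule weight_split_iso)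
next
  assume "cyclic_Ainf (tate_hochschild TYPE('k) TYPE('g))"
  then show "cyclic_Ainf (galg_tensor TYPE('g) (tate_group TYPE('k) TYPE('g)))"
    by (rule cyclic_transport.cyclic_Ainf_B[OF cyclic_transport.intro[OF weight_split_iso _ graded_tensor]])
qed

end
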